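(* Let $\mathbf T$ be a troupe, let $f_1,\ldots,f_r$ be insertion-additive tree statistics, let $x_1,\dots,x_r$ be variables, and let $\mathbb K=\mathbb C(x_1,\ldots,x_r)$. Let \[\mathbf G^{(x_1,\ldots,x_r)}(y)=\sum_{\ell\geq 0}\sum_{T\in\mathbf T_\ell}x_1^{f_1(T)}\cdots x_r^{f_r(T)}y^\ell\] and \[I_{x_1,\ldots,x_r}(z,y)=\sum_{\ell\geq 0}\sum_{n\geq 0}\ \sum_{\mathcal T\in\mathcal P^{-1}(\mathcal D_{\geq\ell}(n))\cap\overline{\mathsf D}\mathbf T}x_1^{\ddot f_1(\mathcal T)}\cdots x_r^{\ddot f_r(\mathcal T)}z^ny^\ell.\] If $\mathbf G^{(x_1,\ldots,x_r)}(y)$ is algebraic over $\mathbb K(y)$, then $I_{x_1,\ldots,x_r}(z,y)$ is algebraic over $\mathbb K(z,y)$ and, consequently, $I_{x_1,\ldots,x_r}(z,0)$ is algebraic over $\mathbb K(z)$.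
   Context: Trees and troupes. Fix a finite set $\mathbf C$ of colors containing black and white. A binary plane tree is a finite (possibly empty) rooted tree in which every vertex has at most two children, every child is designated as either a left child or a right child (not both), and no vertex has two left children or two right children. A colored binary plane tree is a binary plane tree together with a function from its vertex set to $\mathbf C$; trees are considered up to isomorphism, and $\mathsf{CBPT}$ is the set of colored binary plane trees. $\mathbf T_n$ is the set of trees in $\mathbf T$ with $n$ vertices. Insertion: for nonempty $T_1,T_2\in\mathsf{CBPT}$ and a vertex $v$ of $T_1$, replace $v$ by two vertices joined by a left edge: the lower one is still called $v$ (it keeps the color and the left/right subtrees of $v$), and the upper one $v^*$ is black, takes the place of $v$ with respect to the parent of $v$ (if any), and has $v$ as left child; then attach $T_2$ as the right subtree of $v^*$. The result is $\nabla_v(T_1,T_2)$. Decomposition: if $v^*$ is a black vertex with $2$ children in $T$, let $v$ be its left child and $T_2$ its right subtree; delete $T_2$ and contract the edge $vv^*$ to a single vertex identified with $v$ (with the color of $v$), giving $T_1$; then $\Delta_{v^*}(T)=(T_1,T_2)$. A troupe is a set $\mathbf T\subseteq\mathsf{CBPT}$ such that: (i) $\nabla_v(T_1,T_2)\in\mathbf T$ for all nonempty $T_1,T_2\in\mathbf T$ and all vertices $v$ of $T_1$; (ii) $\Delta_{v^*}(T)\in\mathbf T\times\mathbf T$ for every $T\in\mathbf T$ and every black vertex $v^*$ of $T$ with $2$ children; (iii) for every $T\in\mathbf T$, all vertices of $T$ with $2$ children are black. Statistics. A tree statistic is a function $f:\mathsf{CBPT}\to\mathbb C$; it is insertion-additive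 if $f(\nabla_v(T_1,T_2))=f(T_1)+f(T_2)$ for all nonempty $T_1,T_2\in\mathsf{CBPT}$ and all vertices $v$ of $T_1$. Decreasing trees and postorder. $\overline{\mathsf D}\mathbf T$ is the set of labeled trees $\mathcal T$ obtained from a tree in $\mathbf T$ (the skeleton $\mathrm{skel}(\mathcal T)$) with, say, $m$ vertices by bijectively labeling the vertices with $1,\dots,m$ so that every nonroot vertex has a smaller label than its parent; $\ddot f(\mathcal T)=f(\mathrm{skel}(\mathcal T))$. The postorder reading is defined by: $\mathcal P$ of the empty tree is empty, and $\mathcal P(\mathcal T)=\mathcal P(\mathcal T_L)\,\mathcal P(\mathcal T_R)\,m$ if $\mathcal T$ has root label $m$ and left and right subtrees $\mathcal T_L,\mathcal T_R$. $\mathcal P^{-1}(A)$ is the set of trees whose postorder reading lies in $A$. Permutations. $\mathrm{Av}_n(231)$ is the set of permutations $\pi$ of $\{1,\dots,n\}$ with no indices $i_1<i_2<i_3$ such that $\pi_{i_3}<\pi_{i_1}<\pi_{i_2}$. The tail length $\mathrm{tl}(\pi)$ of a permutation $\pi$ of $\{1,\dots,n\}$ is the largest $\ell\in\{0,\ldots,n\}$ such that $\pi_i=i$ for all $i\in\{n-\ell+1,\ldots,n\}$. $\mathcal D_{\geq\ell}(n)=\{\pi\in\mathrm{Av}_{n+\ell}(231):\mathrm{tl}(\pi)\geq\ell\}$. "Algebraic over $\mathbb K(y)$" means satisfying a nontrivial polynomial equation with coefficients in $\mathbb K(y)$, and similarly for the other fields. *)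

theory Defs
  imports
    "HOL-Library.Tree"
    "HOL-Library.Poly_Mapping"
    "HOL-Combinatorics.Multiset_Permutations"
    "HOL-Computational_Algebra.Computational_Algebra"
begin

section \<open>Colored binary plane trees and troupes\<close>

text \<open>
  A colored binary plane tree is a \<^typ>\<open>'c tree\<close>: \<^const>\<open>Leaf\<close> is the empty tree, each
  \<^const>\<open>Node\<close> is a vertex carrying its color, and \<^const>\<open>size\<close> counts the vertices.
  A vertex is represented by the path that leads to it from the root.
\<close>

datatype dir = Lft | Rgt

fun vertices :: "'a tree \<Rightarrow> dir list set" where
  "vertices Leaf = {}"
| "vertices (Node l a r) = {[]} \<union> (#) Lft ` vertices l \<union> (#) Rgt ` vertices r"

fun subtree_at :: "'a tree \<Rightarrow> dir list \<Rightarrow> 'a tree" where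
  "subtree_at t [] = t"
| "subtree_at t (Lft # p) = subtree_at (left t) p"
| "subtree_at t (Rgt # p) = subtree_at (right t) p"

fun replace_at :: "'a tree \<Rightarrow> dir list \<Rightarrow> 'a tree \<Rightarrow> 'a tree" where
  "replace_at t [] s = s"
| "replace_at Leaf (d # p) s = Leaf"
| "replace_at (Node l a r) (Lft # p) s = Node (replace_at l p s) a r"
| "replace_at (Node l a r) (Rgt # p) s = Node l a (replace_at r p s)"

text \<open>The color or label of the vertex \<open>v\<close>; only meaningful for \<open>v \<in> vertices t\<close>.\<close>

definition val_at :: "'a tree \<Rightarrow> dir list \<Rightarrow> 'a" where
  "val_at t v = value (subtree_at t v)"

definition two_children :: "'a tree \<Rightarrow> dir list \<Rightarrow> bool" where
  "two_children t v \<longleftrightarrow> left (subtree_at t v) \<noteq> Leaf \<and> right (subtree_at t v) \<noteq> Leaf"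

text \<open>
  Insertion at \<open>v\<close>: the subtree \<open>S\<close> of \<open>T1\<close> rooted at \<open>v\<close> is replaced by the tree whose root is
  the new black vertex, with left subtree \<open>S\<close> and right subtree \<open>T2\<close>.
\<close>

definition insertion :: "'c \<Rightarrow> dir list \<Rightarrow> 'c tree \<Rightarrow> 'c tree \<Rightarrow> 'c tree" where
  "insertion black v T1 T2 = replace_at T1 v (Node (subtree_at T1 v) black T2)"

text \<open>
  Decomposition at \<open>v\<close>: deleting the right subtree of \<open>v\<close> and contracting the edge from \<open>v\<close> to its
  left child (which keeps the color of the child) leaves the left subtree of \<open>v\<close> in the place of \<open>v\<close>.
\<close>

definition decomposition :: "dir list \<Rightarrow> 'c tree \<Rightarrow> 'c tree \<times> 'c tree" where
  "decomposition v T = (replace_at T v (left (subtree_at T v)), right (subtree_at T v))"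

definition troupe :: "'c \<Rightarrow> 'c tree set \<Rightarrow> bool" where
  "troupe black \<T> \<longleftrightarrow>
     (\<forall>T1\<in>\<T>. \<forall>T2\<in>\<T>. T1 \<noteq> Leaf \<longrightarrow> T2 \<noteq> Leaf \<longrightarrow> (\<forall>v\<in>vertices T1. insertion black v T1 T2 \<in> \<T>)) \<and>
     (\<forall>T\<in>\<T>. \<forall>v\<in>vertices T. val_at T v = black \<longrightarrow> two_children T v \<longrightarrow> decomposition v T \<in> \<T> \<times> \<T>) \<and>
     (\<forall>T\<in>\<T>. \<forall>v\<in>vertices T. two_children T v \<longrightarrow> val_at T v = black)"

definition insertion_additive :: "'c \<Rightarrow> ('c tree \<Rightarrow> complex) \<Rightarrow> bool" where
  "insertion_additive black f \<longleftrightarrow>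
     (\<forall>T1 T2. T1 \<noteq> Leaf \<longrightarrow> T2 \<noteq> Leaf \<longrightarrow>
        (\<forall>v\<in>vertices T1. f (insertion black v T1 T2) = f T1 + f T2))"


section \<open>Decreasing trees, postorder and 231-avoiding permutations\<close>

text \<open>Labeled trees carry pairs (color, label).\<close>

definition skel :: "('c \<times> nat) tree \<Rightarrow> 'c tree" where
  "skel t = map_tree fst t"

definition label_at :: "('c \<times> nat) tree \<Rightarrow> dir list \<Rightarrow> nat" where
  "label_at t v = snd (val_at t v)"

definition decreasing_trees :: "'c tree set \<Rightarrow> ('c \<times> nat) tree set" where
  "decreasing_trees \<T> = {t. skel t \<in> \<T> \<and>
     bij_betw (label_at t) (vertices t) {1..size t} \<and>
     (\<forall>v d. v @ [d] \<in> vertices t \<longrightarrow> label_at t (v @ [d]) < label_at t v)}"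

definition postorder_reading :: "('c \<times> nat) tree \<Rightarrow> nat list" where
  "postorder_reading t = map snd (postorder t)"

text \<open>
  Permutations of \<open>{1..n}\<close> in one-line notation; as list indices start at \<open>0\<close>,
  \<open>\<pi> ! (i - 1)\<close> is the value of the permutation at \<open>i\<close>.
\<close>

definition Av231 :: "nat \<Rightarrow> nat list set" where
  "Av231 n = {\<pi> \<in> permutations_of_set {1..n}.
     \<not> (\<exists>i1 i2 i3. i1 < i2 \<and> i2 < i3 \<and> i3 < n \<and> \<pi> ! i3 < \<pi> ! i1 \<and> \<pi> ! i1 < \<pi> ! i2)}"

definition tail_length :: "nat list \<Rightarrow> nat" where
  "tail_length \<pi> = Max {l \<in> {0..length \<pi>}. \<forall>i\<in>{length \<pi> - l + 1..length \<pi>}. \<pi> ! (i - 1) = i}"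

definition D_ge :: "nat \<Rightarrow> nat \<Rightarrow> nat list set" where
  "D_ge l n = {\<pi> \<in> Av231 (n + l). tail_length \<pi> \<ge> l}"


section \<open>Coefficients\<close>

text \<open>
  Tree statistics are complex valued, so the monomials \<open>x\<^sub>i\<^sup>a\<close> are needed for all complex \<open>a\<close>.
  They live in the group algebra over the complex numbers of the finitely supported exponent
  vectors with complex entries. It contains the polynomial ring in the \<open>x\<^sub>i\<close>, and it is an
  integral domain; its field of fractions is the ambient field for the coefficients, and
  \<open>\<complex>(x\<^sub>0, \<dots>, x\<^sub>r\<^sub>-\<^sub>1)\<close> is a subfield of it.

  The complex exponents are wrapped into a type of their own only in order to give them the
  lexicographic order, which makes the instance of \<^class>\<open>idom\<close> for \<^type>\<open>poly_mapping\<close> applicable.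
\<close>

datatype cexponent = Cexponent (exponent: complex)

instantiation cexponent :: linordered_ab_group_add
begin

definition "0 = Cexponent 0"
definition "a + b = Cexponent (exponent a + exponent b)"
definition "a - b = Cexponent (exponent a - exponent b)"
definition "- a = Cexponent (- exponent a)"
definition "a \<le> b \<longleftrightarrow> Re (exponent a) < Re (exponent b) \<or>
  Re (exponent a) = Re (exponent b) \<and> Im (exponent a) \<le> Im (exponent b)"
definition "a < b \<longleftrightarrow> Re (exponent a) < Re (exponent b) \<or>
  Re (exponent a) = Re (exponent b) \<and> Im (exponent a) < Im (exponent b)"

instance
  by standard
    (auto simp: zero_cexponent_def plus_cexponent_def minus_cexponent_def uminus_cexponent_def
       less_eq_cexponent_def less_cexponent_def complex_eq_iff intro!: cexponent.expand)

end

type_synonym coeff_field = "((nat \<Rightarrow>\<^sub>0 cexponent) \<Rightarrow>\<^sub>0 complex) fract"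

definition coeff_const :: "complex \<Rightarrow> coeff_field" where
  "coeff_const c = to_fract (Poly_Mapping.single 0 c)"

definition xpow :: "nat \<Rightarrow> complex \<Rightarrow> coeff_field" where
  "xpow i a = to_fract (Poly_Mapping.single (Poly_Mapping.single i (Cexponent a)) 1)"


section \<open>Algebraicity\<close>

inductive_set generated_subfield :: "'a::field set \<Rightarrow> 'a set" for A where
  incl: "a \<in> A \<Longrightarrow> a \<in> generated_subfield A"
| zero: "0 \<in> generated_subfield A"
| one: "1 \<in> generated_subfield A"
| add: "a \<in> generated_subfield A \<Longrightarrow> b \<in> generated_subfield A \<Longrightarrow> a + b \<in> generated_subfield A"
| uminus: "a \<in> generated_subfield A \<Longrightarrow> - a \<in> generated_subfield A"
| mult: "a \<in> generated_subfield A \<Longrightarrow> b \<in> generated_subfield A \<Longrightarrow> a * b \<in> generated_subfield A"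
| inverse: "a \<in> generated_subfield A \<Longrightarrow> inverse a \<in> generated_subfield A"

definition algebraic_over :: "'a::field set \<Rightarrow> 'a \<Rightarrow> bool" where
  "algebraic_over K x \<longleftrightarrow> (\<exists>p. p \<noteq> 0 \<and> (\<forall>i. coeff p i \<in> K) \<and> poly p x = 0)"

text \<open>The field \<open>K = \<complex>(x\<^sub>0, \<dots>, x\<^sub>r\<^sub>-\<^sub>1)\<close>.\<close>

definition base_field :: "nat \<Rightarrow> coeff_field set" where
  "base_field r = generated_subfield (range coeff_const \<union> {xpow i 1 | i. i < r})"

text \<open>\<open>K(t)\<close> inside the field of fractions of the power series in one variable \<open>t\<close>.\<close>

definition ratfun_field1 :: "nat \<Rightarrow> coeff_field fps fract set" where
  "ratfun_field1 r = generated_subfield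
     ((\<lambda>c. to_fract (fps_const c)) ` base_field r \<union> {to_fract fps_X})"

text \<open>
  Power series in \<open>z\<close> and \<open>y\<close> are power series in \<open>y\<close> whose coefficients are power series in \<open>z\<close>, so
  the variables are \<open>z = fps_const fps_X\<close> and \<open>y = fps_X\<close>, and setting \<open>y = 0\<close> is taking \<open>fps_nth _ 0\<close>.
\<close>

definition ratfun_field2 :: "nat \<Rightarrow> coeff_field fps fps fract set" where
  "ratfun_field2 r = generated_subfield
     ((\<lambda>c. to_fract (fps_const (fps_const c))) ` base_field r \<union>
      {to_fract (fps_const fps_X), to_fract fps_X})"


section \<open>The generating functions\<close>

definition weight :: "nat \<Rightarrow> (nat \<Rightarrow> 'c tree \<Rightarrow> complex) \<Rightarrow> 'c tree \<Rightarrow> coeff_field" where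
  "weight r f T = (\<Prod>i<r. xpow i (f i T))"

definition G_series :: "'c tree set \<Rightarrow> nat \<Rightarrow> (nat \<Rightarrow> 'c tree \<Rightarrow> complex) \<Rightarrow> coeff_field fps" where
  "G_series \<T> r f = Abs_fps (\<lambda>l. \<Sum>T\<in>{T \<in> \<T>. size T = l}. weight r f T)"

definition I_series :: "'c tree set \<Rightarrow> nat \<Rightarrow> (nat \<Rightarrow> 'c tree \<Rightarrow> complex) \<Rightarrow> coeff_field fps fps" where
  "I_series \<T> r f = Abs_fps (\<lambda>l. Abs_fps (\<lambda>n.
     \<Sum>t\<in>postorder_reading -` D_ge l n \<inter> decreasing_trees \<T>. weight r f (skel t)))"

text \<open>The sums above are over finite sets, as the set of colors is finite.\<close>

lemma finite_trees:
  assumes "finite A"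
  shows "finite {t. set_tree t \<subseteq> A \<and> size t \<le> n}"
proof (induction n)
  case 0
  have "{t. set_tree t \<subseteq> A \<and> size t \<le> 0} \<subseteq> {Leaf}" by auto
  then show ?case using finite_subset by blast
next
  case (Suc n)
  let ?S = "{t. set_tree t \<subseteq> A \<and> size t \<le> n}"
  have "t \<in> insert Leaf ((\<lambda>(l, a, r). Node l a r) ` (?S \<times> A \<times> ?S))"
    if "set_tree t \<subseteq> A" "size t \<le> Suc n" for t
    using that by (cases t) (auto simp: image_iff)
  then have "{t. set_tree t \<subseteq> A \<and> size t \<le> Suc n}
      \<subseteq> insert Leaf ((\<lambda>(l, a, r). Node l a r) ` (?S \<times> A \<times> ?S))" by blast
  then show ?case using Suc assms by (elim finite_subset) auto
qed

lemma finite_G_index: "finite {T \<in> \<T>. size (T :: 'c::finite tree) = l}"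
  by (rule finite_subset[OF _ finite_trees[of UNIV l]]) auto

lemma finite_I_index:
  "finite (postorder_reading -` D_ge l n \<inter> decreasing_trees (\<T> :: 'c::finite tree set))"
proof (rule finite_subset[OF _ finite_trees[of "UNIV \<times> {1..n + l}" "n + l"]])
  show "postorder_reading -` D_ge l n \<inter> decreasing_trees \<T>
      \<subseteq> {t. set_tree t \<subseteq> UNIV \<times> {1..n + l} \<and> size t \<le> n + l}"
  proof
    fix t assume t: "t \<in> postorder_reading -` D_ge l n \<inter> decreasing_trees \<T>"
    then have "postorder_reading t \<in> permutations_of_set {1..n + l}"
      by (auto simp: D_ge_def Av231_def)
    then have "length (postorder_reading t) = n + l" and "set (postorder_reading t) = {1..n + l}"
      using length_finite_permutations_of_set by (force simp: permutations_of_set_def)+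
    then show "t \<in> {t. set_tree t \<subseteq> UNIV \<times> {1..n + l} \<and> size t \<le> n + l}"
      by (auto simp: postorder_reading_def simp del: atLeastAtMost_iff)
        (metis imageI snd_conv)
  qed
qed simp

end

theory Submission
  imports Defs "HOL-Library.Sublist" "HOL-Algebra.Algebraic_Closure_Type"
begin

text \<open>
  Write \<open>G(y)\<close> and \<open>I(z, y)\<close> for the two series of the theorem and \<open>F(z) = I(z, 0)\<close>. There are three steps:
  a functional equation for \<open>I\<close>, its solution, and the algebraicity of that solution.

  \<^bold>\<open>Functional equation.\<close> The permutations counted by the coefficient of \<open>z\<^sup>n y\<^sup>l\<close> are
  \<open>\<sigma> (n+1) \<dots> (n+l)\<close> with \<open>\<sigma> \<in> Av\<^sub>n(231)\<close>. For \<open>n = 0\<close> the reading is increasing, so that a decreasing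
  tree is the same thing as its skeleton; this gives \<open>G\<close>. Let \<open>n > 0\<close> and \<open>\<sigma> = L n R\<close>. Avoiding 231 means that
  \<open>L\<close> and \<open>R\<close> avoid it and that \<open>L\<close> lies below \<open>R\<close>. If \<open>R\<close> is empty, then \<open>n\<close> belongs to a
  tail of length \<open>l + 1\<close>. Otherwise, the vertex \<open>n\<close> is followed in postorder by a smaller label. Hence it is
  the left child of a vertex \<open>v\<close> with two children, which is black because of the troupe property, and the label of \<open>v\<close>
  is some \<open>n + i\<close> of the tail. The decomposition at \<open>v\<close> leaves two trees, with readings
  \<open>L n (n+i+1) \<dots> (n+l)\<close> and \<open>R (n+1) \<dots> (n+i-1)\<close>, and it can be undone by an insertion. As the statistics
  are insertion-additive, the weights multiply (\<open>reading_weight_hooks\<close>, \<open>tail_weight_Suc\<close>), and summing gives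
  \<open>y (I - G) = z (I - F) (1 + y (I - G))\<close> (\<open>I_series_functional_equation\<close>).

  \<^bold>\<open>Solution.\<close> This is a quadratic equation for \<open>I\<close> whose coefficients contain the unknown \<open>F\<close>. Let \<open>Y(z)\<close> be the
  compositional inverse of \<open>y / (1 + y\<^sup>2 G'(y))\<^sup>2\<close>. Substituting \<open>y = Y(z)\<close> into the equation and
  into its derivative with respect to \<open>y\<close> shows that the quadratic polynomial has a double root there, and the two
  relations determine \<open>F = G(Y) - Y\<^sup>3 G'(Y)\<^sup>2\<close> (\<open>catalytic_parametrization\<close>).

  \<^bold>\<open>Algebraicity.\<close> If \<open>G\<close> is algebraic over \<open>K(y)\<close>, then so is \<open>G'\<close>, by differentiating a minimal
  equation. Compositional inverses of algebraic series are algebraic, because substituting the inverse into a polynomial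
  relation exchanges the two variables, and so are compositions. Hence \<open>Y\<close> and \<open>F\<close> are
  algebraic over \<open>K(z)\<close>, and \<open>I\<close> is a root of a quadratic polynomial over an algebraic extension of \<open>K(z, y)\<close>.
\<close>

hide_const (open) up_ring.coeff Polynomials.degree module.smult

section \<open>Decreasing trees and their postorder readings\<close>

text \<open>
  The order condition on labels in recursive form, which is the one that suits structural induction;
  \<open>decreasing_iff\<close> below relates it to the parent-child condition on paths.
\<close>

fun decreasing :: "('c \<times> nat) tree \<Rightarrow> bool" where
  "decreasing Leaf \<longleftrightarrow> True"
| "decreasing (Node l a r) \<longleftrightarrow>
     decreasing l \<and> decreasing r \<and> (\<forall>b\<in>set_tree l \<union> set_tree r. snd b < snd a)"

definition trees_reading :: "'c tree set \<Rightarrow> nat list \<Rightarrow> ('c \<times> nat) tree set" where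
  "trees_reading \<T> \<pi> = {t. skel t \<in> \<T> \<and> decreasing t \<and> postorder_reading t = \<pi>}"

lemma skel_simps [simp]: "skel Leaf = Leaf" "skel (Node l a r) = Node (skel l) (fst a) (skel r)"
  by (simp_all add: skel_def)

lemma skel_eq_Leaf_iff [simp]: "skel t = Leaf \<longleftrightarrow> t = Leaf"
  by (cases t) simp_all

lemma size_skel [simp]: "size (skel t) = size t"
  by (simp add: skel_def)

lemma postorder_reading_simps [simp]:
  "postorder_reading Leaf = []"
  "postorder_reading (Node l a r) = postorder_reading l @ postorder_reading r @ [snd a]"
  by (simp_all add: postorder_reading_def)

lemma postorder_reading_eq_Nil_iff [simp]: "postorder_reading t = [] \<longleftrightarrow> t = Leaf"
  by (cases t) simp_all

lemma set_postorder_reading: "set (postorder_reading t) = snd ` set_tree t"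
  by (simp add: postorder_reading_def)

lemma length_postorder_reading [simp]: "length (postorder_reading t) = size t"
  by (simp add: postorder_reading_def)

lemma subtree_at_Leaf [simp]: "subtree_at Leaf p = Leaf"
proof (induction p)
  case (Cons d p)
  then show ?case by (cases d) simp_all
qed simp

lemma in_vertices_iff: "p \<in> vertices t \<longleftrightarrow> subtree_at t p \<noteq> Leaf"
proof (induction t arbitrary: p)
  case (Node l a r)
  show ?case
  proof (cases p)
    case (Cons d q)
    then show ?thesis using Node by (cases d) auto
  qed simp
qed simp

lemma finite_vertices [simp]: "finite (vertices t)"
  by (induction t) auto

lemma card_vertices: "card (vertices t) = size t"
proof (induction t)
  case (Node l a r)
  have "card (vertices (Node l a r)) = Suc (card ((#) Lft ` vertices l \<union> (#) Rgt ` vertices r))"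
    by (subst card_insert_disjoint[symmetric]) auto
  also have "card ((#) Lft ` vertices l \<union> (#) Rgt ` vertices r) = size l + size r"
    by (subst card_Un_disjoint) (auto simp: card_image Node)
  finally show ?case by simp
qed simp

lemma replace_at_subtree_at [simp]: "replace_at t p (subtree_at t p) = t"
  by (induction t p "subtree_at t p" rule: replace_at.induct) auto

lemma subtree_at_replace_at [simp]: "p \<in> vertices t \<Longrightarrow> subtree_at (replace_at t p s) p = s"
  by (induction t p s rule: replace_at.induct) auto

lemma replace_at_replace_at [simp]: "replace_at (replace_at t p s) p s' = replace_at t p s'"
  by (induction t p s rule: replace_at.induct) auto

lemma subtree_at_append: "subtree_at t (p @ q) = subtree_at (subtree_at t p) q"
  by (induction t p rule: subtree_at.induct) auto

lemma skel_subtree_at: "skel (subtree_at t p) = subtree_at (skel t) p"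
proof (induction t p rule: subtree_at.induct)
  case (2 t p)
  then show ?case by (cases t) auto
next
  case (3 t p)
  then show ?case by (cases t) auto
qed simp

lemma skel_replace_at: "skel (replace_at t p s) = replace_at (skel t) p (skel s)"
  by (induction t p s rule: replace_at.induct) auto

lemma vertices_skel [simp]: "vertices (skel t) = vertices t"
  by (induction t) auto

text \<open>
  The vertices of a subtree are consecutive in postorder, so that exchanging the subtree changes only this factor
  of the reading. This is what turns insertion and decomposition into operations on readings.
\<close>

lemma postorder_reading_replace_at:
  assumes "p \<in> vertices t"
  obtains pre post where
    "\<And>s. postorder_reading (replace_at t p s) = pre @ postorder_reading s @ post"
proof -
  have "\<exists>pre post. \<forall>s. postorder_reading (replace_at t p s) = pre @ postorder_reading s @ post"
    using assms
  proof (induction t arbitrary: p)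
    case (Node l a r)
    show ?case
    proof (cases p)
      case Nil
      then show ?thesis by (intro exI[of _ "[]"]) simp
    next
      case (Cons d q)
      show ?thesis
      proof (cases d)
        case Lft
        then obtain pre post where "\<forall>s. postorder_reading (replace_at l q s) = pre @ postorder_reading s @ post"
          using Node.IH(1)[of q] Node.prems Cons by auto
        then show ?thesis using Cons Lft
          by (intro exI[of _ pre] exI[of _ "post @ postorder_reading r @ [snd a]"]) simp
      next
        case Rgt
        then obtain pre post where "\<forall>s. postorder_reading (replace_at r q s) = pre @ postorder_reading s @ post"
          using Node.IH(2)[of q] Node.prems Cons by auto
        then show ?thesis using Cons Rgt
          by (intro exI[of _ "postorder_reading l @ pre"] exI[of _ "post @ [snd a]"]) simp
      qed
    qed
  qed simp
  then show thesis using that by blast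
qed

lemma label_at_Node [simp]:
  "label_at (Node l a r) [] = snd a"
  "label_at (Node l a r) (Lft # p) = label_at l p"
  "label_at (Node l a r) (Rgt # p) = label_at r p"
  by (simp_all add: label_at_def val_at_def)

lemma label_at_image_vertices: "label_at t ` vertices t = set (postorder_reading t)"
  by (induction t) (auto simp: image_Un image_image)

text \<open>
  With distinct labels a vertex is determined by its label. There are as many vertices as letters in the
  reading, so that it suffices to compare cardinalities.
\<close>

lemma inj_on_label_at:
  assumes "distinct (postorder_reading t)"
  shows "inj_on (label_at t) (vertices t)"
  by (rule eq_card_imp_inj_on)
    (simp_all add: label_at_image_vertices distinct_card[OF assms] card_vertices)

lemma decreasing_le_root:
  "decreasing (Node l a r) \<Longrightarrow> b \<in> set_tree (Node l a r) \<Longrightarrow> snd b \<le> snd a"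
  by (auto simp: less_imp_le)

lemma decreasing_iff:
  "(\<forall>v d. v @ [d] \<in> vertices t \<longrightarrow> label_at t (v @ [d]) < label_at t v) \<longleftrightarrow> decreasing t"
  (is "?P t \<longleftrightarrow> _")
proof (induction t)
  case (Node l a r)
  have root: "(\<forall>b\<in>set_tree s. snd b < snd a) \<longleftrightarrow> (s \<noteq> Leaf \<longrightarrow> label_at s [] < snd a)"
    if "decreasing s" for s :: "('a \<times> nat) tree"
    using that decreasing_le_root by (cases s) (force simp del: decreasing.simps)+
  have P: "?P (Node l a r) \<longleftrightarrow> ?P l \<and> ?P r \<and>
      (l \<noteq> Leaf \<longrightarrow> label_at l [] < snd a) \<and> (r \<noteq> Leaf \<longrightarrow> label_at r [] < snd a)"
    (is "?L \<longleftrightarrow> ?R")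
  proof
    assume L: ?L
    have "?P l" "?P r"
    proof safe
      fix v d
      show "label_at l (v @ [d]) < label_at l v" if "v @ [d] \<in> vertices l"
        using L[rule_format, of "Lft # v" d] that by simp
      show "label_at r (v @ [d]) < label_at r v" if "v @ [d] \<in> vertices r"
        using L[rule_format, of "Rgt # v" d] that by simp
    qed
    moreover have "label_at l [] < snd a" if "l \<noteq> Leaf"
      using L[rule_format, of "[]" Lft] that by (simp add: in_vertices_iff)
    moreover have "label_at r [] < snd a" if "r \<noteq> Leaf"
      using L[rule_format, of "[]" Rgt] that by (simp add: in_vertices_iff)
    ultimately show ?R by blast
  next
    assume R: ?R
    show ?L
    proof safe
      fix v d assume "v @ [d] \<in> vertices (Node l a r)"
      then show "label_at (Node l a r) (v @ [d]) < label_at (Node l a r) v"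
        using R by (cases v; cases d) (auto simp: in_vertices_iff split: if_splits)
    qed
  qed
  show ?case unfolding P Node.IH using root by auto
qed simp

text \<open>
  Once the reading is a permutation of \<open>{1..N}\<close>, the bijectivity of the labelling is automatic, and a decreasing
  tree is just a tree over the troupe with decreasing labels.
\<close>

lemma decreasing_trees_reading:
  assumes "\<pi> \<in> permutations_of_set {1..N}"
  shows "postorder_reading -` {\<pi>} \<inter> decreasing_trees \<T> = trees_reading \<T> \<pi>"
proof -
  have "bij_betw (label_at t) (vertices t) {1..size t}" if "postorder_reading t = \<pi>" for t :: "('a \<times> nat) tree"
  proof -
    have "set \<pi> = {1..N}" "distinct \<pi>" using assms by (auto simp: permutations_of_set_def)
    moreover from this have "size t = N"
      using distinct_card[of \<pi>] that length_postorder_reading[of t] by simp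
    ultimately show ?thesis
      using inj_on_label_at[of t] label_at_image_vertices[of t] that
      by (simp add: bij_betw_def)
  qed
  then show ?thesis
    unfolding decreasing_trees_def trees_reading_def decreasing_iff by auto
qed

lemma decreasing_subtree_at: "decreasing t \<Longrightarrow> decreasing (subtree_at t p)"
proof (induction t p rule: subtree_at.induct)
  case (2 t p)
  then show ?case by (cases t) auto
next
  case (3 t p)
  then show ?case by (cases t) auto
qed simp

lemma set_tree_subtree_at: "set_tree (subtree_at t p) \<subseteq> set_tree t"
proof (induction t p rule: subtree_at.induct)
  case (2 t p)
  then show ?case by (cases t) auto
next
  case (3 t p)
  then show ?case by (cases t) auto
qed simp

lemma set_tree_replace_at: "set_tree (replace_at t p s) \<subseteq> set_tree t \<union> set_tree s"
  by (induction t p s rule: replace_at.induct) auto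

text \<open>
  Only the ancestors of \<open>p\<close> have to be compared with the new subtree, but ancestors are inconvenient to speak of.
  The last hypothesis replaces them by all vertices whose label exceeds the whole old subtree at \<open>p\<close>, which
  include the ancestors.
\<close>

lemma decreasing_replace_at:
  assumes "decreasing t" "decreasing s" "p \<in> vertices t"
    and "\<And>a b. a \<in> set_tree t \<Longrightarrow> b \<in> set_tree s \<Longrightarrow>
      (\<forall>b'\<in>set_tree (subtree_at t p). snd b' < snd a) \<Longrightarrow> snd b < snd a"
  shows "decreasing (replace_at t p s)"
  using assms
proof (induction t p s rule: replace_at.induct)
  case (3 l a r p s)
  have "\<forall>b'\<in>set_tree (subtree_at l p). snd b' < snd a"
    using set_tree_subtree_at[of l p] 3(2) by auto
  then have "\<forall>b\<in>set_tree s. snd b < snd a" using 3(5)[of a] by simp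
  moreover have "decreasing (replace_at l p s)"
    using 3(2-4) 3(5) by (intro 3(1)) auto
  ultimately show ?case using 3(2) set_tree_replace_at[of l p s] by auto
next
  case (4 l a r p s)
  have "\<forall>b'\<in>set_tree (subtree_at r p). snd b' < snd a"
    using set_tree_subtree_at[of r p] 4(2) by auto
  then have "\<forall>b\<in>set_tree s. snd b < snd a" using 4(5)[of a] by simp
  moreover have "decreasing (replace_at r p s)"
    using 4(2-4) 4(5) by (intro 4(1)) auto
  ultimately show ?case using 4(2) set_tree_replace_at[of r p s] by auto
qed auto

lemma ex_tree_with_reading:
  "length \<pi> = size s \<Longrightarrow> \<exists>t. skel t = s \<and> postorder_reading t = \<pi>"
proof (induction s arbitrary: \<pi>)
  case (Node l c r)
  obtain \<pi>' x where \<pi>: "\<pi> = \<pi>' @ [x]" using Node.prems by (cases \<pi> rule: rev_cases) auto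
  obtain tl where "skel tl = l" "postorder_reading tl = take (size l) \<pi>'"
    using Node.IH(1)[of "take (size l) \<pi>'"] Node.prems \<pi> by auto
  moreover obtain tr where "skel tr = r" "postorder_reading tr = drop (size l) \<pi>'"
    using Node.IH(2)[of "drop (size l) \<pi>'"] Node.prems \<pi> by auto
  ultimately show ?case
    using \<pi> by (intro exI[of _ "Node tl (c, x) tr"]) simp
qed simp

text \<open>
  A labeled tree is determined by its skeleton and its reading, and by \<open>ex_tree_with_reading\<close> every reading of the right
  length occurs. So decreasing trees with a given reading can be counted by their skeletons.
\<close>

lemma tree_eq_if_skel_reading_eq:
  "skel t = skel t' \<Longrightarrow> postorder_reading t = postorder_reading t' \<Longrightarrow> t = t'"
proof (induction t arbitrary: t')
  case (Node l a r)
  obtain l' a' r' where t': "t' = Node l' a' r'" using Node.prems(1) by (cases t') auto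
  have sizes: "size l = size l'" "size r = size r'"
    using Node.prems(1) size_skel[of l] size_skel[of l'] size_skel[of r] size_skel[of r'] by (auto simp: t')
  then have "postorder_reading l = postorder_reading l'" "postorder_reading r = postorder_reading r'"
    using Node.prems(2) by (auto simp: t' append_eq_append_conv)
  then show ?case using Node by (auto simp: t' prod_eq_iff)
qed (metis skel_eq_Leaf_iff skel_simps(1))

lemma inj_on_skel: "inj_on skel (trees_reading \<T> \<pi>)"
  by (auto simp: inj_on_def trees_reading_def intro: tree_eq_if_skel_reading_eq)

lemma decreasing_if_sorted: "sorted_wrt (<) (postorder_reading t) \<Longrightarrow> decreasing t"
  by (induction t) (auto simp: sorted_wrt_append set_postorder_reading)

lemma decreasing_map:
  "strict_mono g \<Longrightarrow> decreasing (map_tree (apsnd g) t) \<longleftrightarrow> decreasing t"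
  by (induction t) (simp_all add: tree.set_map ball_Un strict_mono_less)

lemma skel_map [simp]: "skel (map_tree (apsnd g) t) = skel t"
  by (induction t) auto

lemma postorder_reading_map [simp]: "postorder_reading (map_tree (apsnd g) t) = map g (postorder_reading t)"
  by (induction t) auto

text \<open>
  Only the relative order of the labels matters for being decreasing. This is used to standardise the readings of
  the two pieces of a decomposed tree.
\<close>

lemma skel_image_trees_reading_map:
  assumes "strict_mono g"
  shows "skel ` trees_reading \<T> (map g \<pi>) = skel ` trees_reading \<T> \<pi>"
proof (intro equalityI subsetI)
  fix s assume "s \<in> skel ` trees_reading \<T> \<pi>"
  then obtain t where "t \<in> trees_reading \<T> \<pi>" "s = skel t" by blast
  then show "s \<in> skel ` trees_reading \<T> (map g \<pi>)"
    using decreasing_map[OF assms]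
    by (intro image_eqI[of _ _ "map_tree (apsnd g) t"]) (auto simp: trees_reading_def)
next
  fix s assume "s \<in> skel ` trees_reading \<T> (map g \<pi>)"
  then obtain t where t: "skel t \<in> \<T>" "decreasing t" "postorder_reading t = map g \<pi>" "s = skel t"
    by (auto simp: trees_reading_def)
  have "length \<pi> = size (skel t)" using arg_cong[OF t(3), of length] by simp
  then obtain t' where t': "skel t' = skel t" "postorder_reading t' = \<pi>"
    using ex_tree_with_reading by blast
  have "map_tree (apsnd g) t' = t"
    by (rule tree_eq_if_skel_reading_eq) (simp_all add: t' t)
  then have "decreasing t'" using decreasing_map[OF assms, of t'] t(2) by simp
  then show "s \<in> skel ` trees_reading \<T> \<pi>"
    using t t' by (intro image_eqI[of _ _ t']) (auto simp: trees_reading_def)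
qed

definition reading_weight :: "'c tree set \<Rightarrow> ('c tree \<Rightarrow> 'a::comm_ring_1) \<Rightarrow> nat list \<Rightarrow> 'a" where
  "reading_weight \<T> wt \<pi> = (\<Sum>t\<in>trees_reading \<T> \<pi>. wt (skel t))"

lemma reading_weight_skel: "reading_weight \<T> wt \<pi> = sum wt (skel ` trees_reading \<T> \<pi>)"
  by (simp add: reading_weight_def sum.reindex[OF inj_on_skel])

lemma reading_weight_map: "strict_mono g \<Longrightarrow> reading_weight \<T> wt (map g \<pi>) = reading_weight \<T> wt \<pi>"
  by (simp add: reading_weight_skel skel_image_trees_reading_map)

text \<open>
  In postorder every vertex comes after its descendants, so any tree whose reading is increasing is decreasing. Hence these
  trees are counted by their skeletons alone, as in the series \<open>G\<close>.
\<close>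

lemma reading_weight_sorted:
  assumes "sorted_wrt (<) \<pi>"
  shows "reading_weight \<T> wt \<pi> = (\<Sum>s\<in>{s \<in> \<T>. size s = length \<pi>}. wt s)"
proof -
  have "skel ` trees_reading \<T> \<pi> = {s \<in> \<T>. size s = length \<pi>}"
  proof (intro equalityI subsetI)
    fix s assume s: "s \<in> {s \<in> \<T>. size s = length \<pi>}"
    then obtain t where "skel t = s" "postorder_reading t = \<pi>"
      using ex_tree_with_reading[of \<pi> s] by auto
    then show "s \<in> skel ` trees_reading \<T> \<pi>"
      using s assms decreasing_if_sorted[of t]
      by (intro image_eqI[of _ _ t]) (auto simp: trees_reading_def)
  qed (auto simp: trees_reading_def)
  then show ?thesis by (simp add: reading_weight_skel)
qed

section \<open>Hooks: cutting a decreasing tree at a descent\<close>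

text \<open>
  The successor in postorder of a root or of a right child or only child is, if it exists, its parent, which has a larger label. So a
  vertex \<open>m\<close> followed by a smaller label is a left child with a nonempty sibling subtree.
\<close>

lemma ex_hook:
  assumes "decreasing t" "postorder_reading t = u @ m # v" "v \<noteq> []" "hd v < m"
  shows "\<exists>q a k b k' x T2. subtree_at t q = Node (Node a (k, m) b) (k', x) T2 \<and> T2 \<noteq> Leaf"
  using assms
proof (induction t arbitrary: u v)
  case (Node l ky r)
  have less: "b < snd ky" if "b \<in> set (postorder_reading l) \<union> set (postorder_reading r)" for b
    using that Node.prems(1) by (auto simp: set_postorder_reading)
  have "(\<exists>v'. postorder_reading l = u @ m # v' \<and> v = v' @ postorder_reading r @ [snd ky]) \<or>
      (\<exists>u' v'. postorder_reading r = u' @ m # v' \<and> v = v' @ [snd ky])"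
    using Node.prems(2,3) by (auto simp: append_eq_append_conv2 append_eq_Cons_conv Cons_eq_append_conv)
  then show ?case
  proof (elim disjE exE conjE)
    fix v' assume l: "postorder_reading l = u @ m # v'" and v: "v = v' @ postorder_reading r @ [snd ky]"
    show ?thesis
    proof (cases "v' = []")
      case True
      obtain a km b where ab: "l = Node a km b" "snd km = m"
        using l True by (cases l) auto
      have "r \<noteq> Leaf"
        using Node.prems(4) less[of m] l True v by auto
      then have "subtree_at (Node l ky r) [] = Node (Node a (fst km, m) b) (fst ky, snd ky) r \<and> r \<noteq> Leaf"
        using ab by auto
      then show ?thesis by blast
    next
      case False
      then obtain q a k b k' x T2 where "subtree_at l q = Node (Node a (k, m) b) (k', x) T2 \<and> T2 \<noteq> Leaf"
        using Node.IH(1)[OF _ l] Node.prems v by auto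
      then have "subtree_at (Node l ky r) (Lft # q) = Node (Node a (k, m) b) (k', x) T2 \<and> T2 \<noteq> Leaf" by simp
      then show ?thesis by blast
    qed
  next
    fix u' v' assume r: "postorder_reading r = u' @ m # v'" and v: "v = v' @ [snd ky]"
    have "v' \<noteq> []" using Node.prems(4) less[of m] r v by auto
    then obtain q a k b k' x T2 where "subtree_at r q = Node (Node a (k, m) b) (k', x) T2 \<and> T2 \<noteq> Leaf"
      using Node.IH(2)[OF _ r] Node.prems v by auto
    then have "subtree_at (Node l ky r) (Rgt # q) = Node (Node a (k, m) b) (k', x) T2 \<and> T2 \<noteq> Leaf" by simp
    then show ?thesis by blast
  qed
qed simp

text \<open>
  Insertion needs a path, but a hook is described by the label \<open>m\<close>. The path is recovered from the label, and
  it is meaningful for trees with distinct labels in which \<open>m\<close> occurs.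
\<close>

definition label_path :: "nat \<Rightarrow> ('c \<times> nat) tree \<Rightarrow> dir list" where
  "label_path m t = the_inv_into (vertices t) (label_at t) m"

lemma label_path:
  assumes "distinct (postorder_reading t)"
  shows "m \<in> set (postorder_reading t) \<Longrightarrow> label_path m t \<in> vertices t"
    and "m \<in> set (postorder_reading t) \<Longrightarrow> label_at t (label_path m t) = m"
    and "p \<in> vertices t \<Longrightarrow> label_at t p = m \<Longrightarrow> label_path m t = p"
  using inj_on_label_at[OF assms] label_at_image_vertices[of t]
  by (auto simp: label_path_def the_inv_into_into f_the_inv_into_f the_inv_into_f_f)

text \<open>
  The labeled version of \<^const>\<open>insertion\<close>: the new black vertex is placed above the vertex labeled \<open>m\<close>
  and receives the label \<open>x\<close>.
\<close>

definition hook_insert :: "'c \<Rightarrow> nat \<Rightarrow> nat \<Rightarrow> ('c \<times> nat) tree \<Rightarrow> ('c \<times> nat) tree \<Rightarrow> ('c \<times> nat) tree" where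
  "hook_insert black m x t1 t2 =
    replace_at t1 (label_path m t1) (Node (subtree_at t1 (label_path m t1)) (black, x) t2)"

lemma label_at_subtree: "label_at t (p @ q) = label_at (subtree_at t p) q"
  by (simp add: label_at_def val_at_def subtree_at_append)

text \<open>
  The readings \<open>u m R c\<close> that occur below: \<open>m\<close> is larger than everything except the
  increasing tail \<open>c\<close>, and it is followed by the smaller label at the head of \<open>R\<close>. So in every tree
  with this reading the parent of \<open>m\<close> has a label \<open>c ! i\<close>, and it comes after \<open>R\<close> and the first
  \<open>i\<close> letters of \<open>c\<close>, which form its right subtree.
\<close>

context
  fixes black :: 'c and \<T> :: "'c tree set" and m :: nat and u R c :: "nat list"
  assumes T: "troupe black \<T>" and dist: "distinct u" "distinct R" "set u \<inter> set R = {}"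
    and c: "sorted_wrt (<) c" and R: "R \<noteq> []"
    and less: "\<And>x. x \<in> set u \<union> set R \<Longrightarrow> x < m" "\<And>x. x \<in> set c \<Longrightarrow> m < x"
begin

lemma distinct_whole: "distinct (u @ m # R @ c)"
proof -
  have "distinct c" using c strict_sorted_iff by blast
  then show ?thesis using dist less by (force simp: disjoint_iff)
qed

lemma hook_parts:
  assumes "i < length c"
  shows "distinct (u @ m # drop (Suc i) c)" "c = take i c @ c ! i # drop (Suc i) c"
    "\<And>y. y \<in> set (drop (Suc i) c) \<Longrightarrow> c ! i < y" "\<And>y. y \<in> set (take i c) \<Longrightarrow> y < c ! i"
proof -
  show eq: "c = take i c @ c ! i # drop (Suc i) c" by (rule id_take_nth_drop[OF assms])
  have "sorted_wrt (<) (take i c @ c ! i # drop (Suc i) c)" using c by (simp flip: eq)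
  then show "\<And>y. y \<in> set (drop (Suc i) c) \<Longrightarrow> c ! i < y" "\<And>y. y \<in> set (take i c) \<Longrightarrow> y < c ! i"
    by (auto simp: sorted_wrt_append)
  have "set (drop (Suc i) c) \<subseteq> set c" by (rule set_drop_subset)
  then show "distinct (u @ m # drop (Suc i) c)" using distinct_whole by auto
qed

text \<open>
  Inserting \<open>t2\<close> at \<open>m\<close> puts its reading and the new label right behind \<open>m\<close>. The result
  is decreasing because every ancestor of \<open>m\<close> in \<open>t1\<close> carries a label from the tail behind \<open>c ! i\<close>. The
  last conclusions say how \<open>t1\<close> and \<open>t2\<close> can be read off from the result.
\<close>

lemma hook_insert:
  assumes i: "i < length c"
    and t1: "t1 \<in> trees_reading \<T> (u @ m # drop (Suc i) c)"
    and t2: "t2 \<in> trees_reading \<T> (R @ take i c)"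
  defines "q \<equiv> label_path m t1" and "t \<equiv> hook_insert black m (c ! i) t1 t2"
  shows "t \<in> trees_reading \<T> (u @ m # R @ c)"
    and "skel t = insertion black q (skel t1) (skel t2)" and "q \<in> vertices (skel t1)"
    and "subtree_at t q = Node (subtree_at t1 q) (black, c ! i) t2"
    and "label_at (subtree_at t1 q) [] = m" "subtree_at t1 q \<noteq> Leaf"
    and "t1 = replace_at t q (subtree_at t1 q)"
proof -
  let ?S = "subtree_at t1 q"
  have r1: "postorder_reading t1 = u @ m # drop (Suc i) c" and d1: "decreasing t1" and s1: "skel t1 \<in> \<T>"
    and r2: "postorder_reading t2 = R @ take i c" and d2: "decreasing t2" and s2: "skel t2 \<in> \<T>"
    using t1 t2 by (auto simp: trees_reading_def)
  have dist1: "distinct (postorder_reading t1)" using hook_parts(1)[OF i] r1 by simp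
  have q: "q \<in> vertices t1" "label_at t1 q = m"
    using label_path(1,2)[OF dist1, of m] r1 by (simp_all add: q_def)
  then show "q \<in> vertices (skel t1)" by simp
  have t: "t = replace_at t1 q (Node ?S (black, c ! i) t2)" by (simp add: t_def hook_insert_def q_def)
  show "subtree_at t q = Node ?S (black, c ! i) t2" unfolding t using q(1) by simp
  show root: "label_at ?S [] = m" using label_at_subtree[of t1 q "[]"] q(2) by simp
  show S: "?S \<noteq> Leaf" using q(1) by (simp add: in_vertices_iff)
  show "t1 = replace_at t q ?S" by (simp add: t)
  show sk: "skel t = insertion black q (skel t1) (skel t2)"
    by (simp add: t skel_replace_at insertion_def skel_subtree_at)
  have "t1 \<noteq> Leaf" "t2 \<noteq> Leaf" using r1 r2 R by auto
  then have "skel t \<in> \<T>" unfolding sk using T s1 s2 q(1) by (simp add: troupe_def)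
  moreover have "postorder_reading t = u @ m # R @ c"
  proof -
    obtain pre post where pp: "\<And>s. postorder_reading (replace_at t1 q s) = pre @ postorder_reading s @ post"
      using postorder_reading_replace_at[OF q(1)] by blast
    obtain \<sigma> where \<sigma>: "postorder_reading ?S = \<sigma> @ [m]"
      using S root by (cases ?S) auto
    have *: "u @ m # drop (Suc i) c = (pre @ \<sigma>) @ m # post"
      using pp[of ?S] r1 \<sigma> by simp
    have "m \<notin> set (drop (Suc i) c)" "m \<notin> set u" using hook_parts(1)[OF i] by auto
    then have "u = pre @ \<sigma>" "post = drop (Suc i) c"
      using * by (metis append_Cons_eq_iff)+
    then show ?thesis using pp[of "Node ?S (black, c ! i) t2"] \<sigma> r2 hook_parts(2)[OF i]
      by (simp add: t)
  qed
  moreover have "decreasing t"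
    unfolding t
  proof (rule decreasing_replace_at[OF d1 _ q(1)])
    obtain a k b where Sn: "?S = Node a k b" "snd k = m" using S root by (cases ?S) auto
    have dS: "decreasing ?S" by (rule decreasing_subtree_at[OF d1])
    then have leS: "snd x \<le> m" if "x \<in> set_tree ?S" for x
      using decreasing_le_root[of a k b x] that Sn by simp
    have ci: "m < c ! i" using less(2) i by simp
    have lt2: "snd x < c ! i" if "x \<in> set_tree t2" for x
    proof -
      have "snd x \<in> set (R @ take i c)" using that unfolding r2[symmetric] set_postorder_reading by blast
      then show ?thesis using less(1) ci hook_parts(4)[OF i] by (auto intro: less_trans)
    qed
    show "decreasing (Node ?S (black, c ! i) t2)"
      using dS d2 leS ci lt2 by (auto intro: le_less_trans)
    fix x y assume x: "x \<in> set_tree t1" and y: "y \<in> set_tree (Node ?S (black, c ! i) t2)"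
      and above: "\<forall>y\<in>set_tree ?S. snd y < snd x"
    have "snd x \<in> set (u @ m # drop (Suc i) c)" using x unfolding r1[symmetric] set_postorder_reading by blast
    moreover have "m < snd x" using above Sn by simp
    ultimately have "snd x \<in> set (drop (Suc i) c)" using less(1)[of "snd x"] by auto
    then have "c ! i < snd x" by (rule hook_parts(3)[OF i])
    moreover have "snd y \<le> c ! i" using y leS[of y] ci lt2[of y] by auto
    ultimately show "snd y < snd x" by simp
  qed
  ultimately show "t \<in> trees_reading \<T> (u @ m # R @ c)" by (simp add: trees_reading_def)
qed

text \<open>
  The inverse construction: by \<open>ex_hook\<close> the parent of \<open>m\<close> has two children, so the troupe makes it black and
  contains both parts of the decomposition there.
\<close>

lemma hook_remove:
  assumes t: "t \<in> trees_reading \<T> (u @ m # R @ c)"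
  obtains i t1 t2 where "i < length c" "t1 \<in> trees_reading \<T> (u @ m # drop (Suc i) c)"
    "t2 \<in> trees_reading \<T> (R @ take i c)" "t = hook_insert black m (c ! i) t1 t2"
proof -
  have r: "postorder_reading t = u @ m # R @ c" and d: "decreasing t" and s: "skel t \<in> \<T>"
    using t by (auto simp: trees_reading_def)
  have dist: "distinct (postorder_reading t)" using distinct_whole r by simp
  have "hd (R @ c) < m" using R less(1) by (cases R) auto
  then obtain q a k b k' x t2 where q: "subtree_at t q = Node (Node a (k, m) b) (k', x) t2" "t2 \<noteq> Leaf"
    using ex_hook[OF d r] R by auto
  then have qv: "q \<in> vertices t" by (simp add: in_vertices_iff)
  let ?S = "Node a (k, m) b"
  define t1 where "t1 = replace_at t q ?S"
  obtain pre post where pp: "\<And>s. postorder_reading (replace_at t q s) = pre @ postorder_reading s @ post"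
    using postorder_reading_replace_at[OF qv] by blast
  define \<sigma> where "\<sigma> = postorder_reading a @ postorder_reading b"
  have split: "u @ m # R @ c = (pre @ \<sigma>) @ m # postorder_reading t2 @ x # post"
    using pp[of "subtree_at t q"] r replace_at_subtree_at[of t q] by (simp add: q(1) \<sigma>_def)
  have "m \<notin> set u" "m \<notin> set (R @ c)" using distinct_whole by auto
  then have u: "u = pre @ \<sigma>" and Rc: "R @ c = postorder_reading t2 @ x # post"
    using split by (metis append_Cons_eq_iff)+
  have dq: "decreasing (subtree_at t q)" by (rule decreasing_subtree_at[OF d])
  then have "m < x" "decreasing t2" "decreasing ?S" by (auto simp: q(1))
  have "x \<in> set (R @ c)" unfolding Rc by simp
  then have "x \<in> set c" using less(1)[of x] \<open>m < x\<close> by auto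
  then obtain i where i: "i < length c" "c ! i = x" by (auto simp: in_set_conv_nth)
  have "(R @ take i c) @ x # drop (Suc i) c = postorder_reading t2 @ x # post"
    using Rc hook_parts(2)[OF i(1)] i(2) by simp
  moreover have "x \<notin> set (R @ take i c)" "x \<notin> set (drop (Suc i) c)"
    using less(1)[of x] \<open>m < x\<close> hook_parts(3,4)[OF i(1), of x] i(2) by auto
  ultimately have rt2: "postorder_reading t2 = R @ take i c" and post: "post = drop (Suc i) c"
    by (metis append_Cons_eq_iff)+
  have sub: "subtree_at (skel t) q = Node (skel ?S) k' (skel t2)"
    using skel_subtree_at[of t q] by (simp add: q(1))
  have two: "two_children (skel t) q" using q(2) by (simp add: two_children_def sub)
  have "val_at (skel t) q = k'" by (simp add: val_at_def sub)
  then have k': "k' = black" using T s two qv unfolding troupe_def by (metis vertices_skel)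
  then have "decomposition q (skel t) \<in> \<T> \<times> \<T>"
    using T s two qv \<open>val_at (skel t) q = k'\<close> unfolding troupe_def by (metis vertices_skel)
  then have sk: "skel t1 \<in> \<T>" "skel t2 \<in> \<T>"
    by (simp_all add: decomposition_def sub t1_def skel_replace_at)
  have r1: "postorder_reading t1 = u @ m # drop (Suc i) c"
    by (simp add: t1_def pp u \<sigma>_def post)
  have d1: "decreasing t1"
    unfolding t1_def by (rule decreasing_replace_at[OF d \<open>decreasing ?S\<close> qv]) (auto simp: q(1))
  have "distinct (postorder_reading t1)" unfolding r1 by (rule hook_parts(1)[OF i(1)])
  moreover have sub1: "subtree_at t1 q = ?S" using qv by (simp add: t1_def)
  ultimately have lp: "label_path m t1 = q"
    by (intro label_path(3)) (auto simp: in_vertices_iff label_at_def val_at_def)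
  have "hook_insert black m (c ! i) t1 t2 = replace_at t1 q (Node ?S (black, x) t2)"
    by (simp only: hook_insert_def lp sub1 i(2))
  also have "\<dots> = t"
    using replace_at_subtree_at[of t q] unfolding q(1) k' by (simp add: t1_def)
  finally have "t = hook_insert black m (c ! i) t1 t2" ..
  then show thesis
    using that[of i t1 t2] i(1) sk d1 r1 rt2 \<open>decreasing t2\<close> by (simp add: trees_reading_def)
qed

text \<open>
  Insertion is a bijection onto the trees with reading \<open>u m R c\<close>, the label of the inserted vertex being one of the
  entries of \<open>c\<close>. It is injective because the inserted vertex is the parent of \<open>m\<close>.
\<close>

lemma reading_weight_hooks:
  fixes wt :: "'c tree \<Rightarrow> 'a::comm_ring_1"
  assumes wt: "\<And>T1 T2 v. T1 \<noteq> Leaf \<Longrightarrow> T2 \<noteq> Leaf \<Longrightarrow> v \<in> vertices T1 \<Longrightarrow>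
    wt (insertion black v T1 T2) = wt T1 * wt T2"
    and fin: "\<And>\<pi>. finite (trees_reading \<T> \<pi>)"
  shows "reading_weight \<T> wt (u @ m # R @ c) =
    (\<Sum>i<length c. reading_weight \<T> wt (u @ m # drop (Suc i) c) * reading_weight \<T> wt (R @ take i c))"
proof -
  let ?P = "\<lambda>i. trees_reading \<T> (u @ m # drop (Suc i) c)" and ?Q = "\<lambda>i. trees_reading \<T> (R @ take i c)"
  let ?D = "SIGMA i:{..<length c}. ?P i \<times> ?Q i"
  let ?h = "\<lambda>(i, t1, t2). hook_insert black m (c ! i) t1 t2"
  have inj: "inj_on ?h ?D"
  proof (rule inj_onI, clarsimp)
    fix i t1 t2 i' t1' t2'
    assume i: "i < length c" "i' < length c" and t: "t1 \<in> ?P i" "t2 \<in> ?Q i" "t1' \<in> ?P i'" "t2' \<in> ?Q i'"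
      and eq: "hook_insert black m (c ! i) t1 t2 = hook_insert black m (c ! i') t1' t2'"
    define q where "q = label_path m t1"
    define q' where "q' = label_path m t1'"
    define t where "t = hook_insert black m (c ! i) t1 t2"
    note h = hook_insert[OF i(1) t(1,2), folded q_def t_def]
    note h' = hook_insert[OF i(2) t(3,4), folded q'_def, folded eq, folded t_def]
    have dist: "distinct (postorder_reading t)" using h(1) distinct_whole by (simp add: trees_reading_def)
    have "q @ [Lft] \<in> vertices t" "label_at t (q @ [Lft]) = m"
      using h(4-6) by (auto simp: in_vertices_iff subtree_at_append label_at_subtree)
    then have "label_path m t = q @ [Lft]" by (rule label_path(3)[OF dist])
    moreover have "q' @ [Lft] \<in> vertices t" "label_at t (q' @ [Lft]) = m"
      using h'(4-6) by (auto simp: in_vertices_iff subtree_at_append label_at_subtree)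
    then have "label_path m t = q' @ [Lft]" by (rule label_path(3)[OF dist])
    ultimately have qq: "q' = q" by simp
    have "c ! i = c ! i'" "t2 = t2'" "subtree_at t1 q = subtree_at t1' q"
      using h(4) h'(4) by (simp_all add: qq)
    moreover have "t1 = t1'" using h(7) h'(7) calculation(3) by (simp add: qq)
    moreover have "distinct c" using distinct_whole by simp
    ultimately show "i = i' \<and> t1 = t1' \<and> t2 = t2'" using i nth_eq_iff_index_eq by auto
  qed
  have img: "?h ` ?D = trees_reading \<T> (u @ m # R @ c)"
  proof (intro equalityI subsetI)
    fix t assume "t \<in> trees_reading \<T> (u @ m # R @ c)"
    then show "t \<in> ?h ` ?D"
      by (rule hook_remove) (auto intro!: image_eqI[of _ _ "(_, _, _)"])
  qed (auto intro: hook_insert(1))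
  have "reading_weight \<T> wt (u @ m # R @ c) = (\<Sum>p\<in>?D. wt (skel (?h p)))"
    unfolding reading_weight_def img[symmetric] by (simp add: sum.reindex[OF inj] o_def)
  also have "\<dots> = (\<Sum>(i, t1, t2)\<in>?D. wt (skel t1) * wt (skel t2))"
  proof (intro sum.cong refl, clarsimp)
    fix i t1 t2 assume *: "i < length c" "t1 \<in> ?P i" "t2 \<in> ?Q i"
    have "t1 \<noteq> Leaf" "t2 \<noteq> Leaf" using *(2,3) R by (auto simp: trees_reading_def)
    then show "wt (skel (hook_insert black m (c ! i) t1 t2)) = wt (skel t1) * wt (skel t2)"
      using hook_insert(3)[OF *] by (simp add: hook_insert(2)[OF *] wt)
  qed
  also have "\<dots> = (\<Sum>i<length c. \<Sum>t1\<in>?P i. \<Sum>t2\<in>?Q i. wt (skel t1) * wt (skel t2))"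
    by (simp add: sum.Sigma fin sum.cartesian_product split_def)
  finally show ?thesis by (simp add: reading_weight_def sum_product)
qed

end

section \<open>Permutations avoiding 231 with a long tail\<close>

text \<open>
  Pattern avoidance in terms of subsequences, for lists that need not be permutations: in this form it behaves well under
  concatenation.
\<close>

definition avoids_231 :: "nat list \<Rightarrow> bool" where
  "avoids_231 \<pi> \<longleftrightarrow> (\<forall>x y z. subseq [x, y, z] \<pi> \<longrightarrow> z < x \<longrightarrow> \<not> x < y)"

lemma subseq_triple_iff:
  "subseq [x, y, z] \<pi> \<longleftrightarrow>
    (\<exists>i j k. i < j \<and> j < k \<and> k < length \<pi> \<and> \<pi> ! i = x \<and> \<pi> ! j = y \<and> \<pi> ! k = z)"
proof
  assume "subseq [x, y, z] \<pi>"
  then obtain a b c d where \<pi>: "\<pi> = a @ x # b @ y # c @ z # d"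
    by (auto dest!: list_emb_ConsD)
  have "\<pi> ! length a = x" "\<pi> ! (length a + 1 + length b) = y"
    "\<pi> ! (length a + 1 + length b + 1 + length c) = z"
    by (simp_all add: \<pi> nth_append)
  then show "\<exists>i j k. i < j \<and> j < k \<and> k < length \<pi> \<and> \<pi> ! i = x \<and> \<pi> ! j = y \<and> \<pi> ! k = z"
    by (intro exI[of _ "length a"] exI[of _ "length a + 1 + length b"]
        exI[of _ "length a + 1 + length b + 1 + length c"]) (simp add: \<pi>)
next
  assume "\<exists>i j k. i < j \<and> j < k \<and> k < length \<pi> \<and> \<pi> ! i = x \<and> \<pi> ! j = y \<and> \<pi> ! k = z"
  then obtain i j k where *: "i < j" "j < k" "k < length \<pi>" "\<pi> ! i = x" "\<pi> ! j = y" "\<pi> ! k = z" by blast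
  have "\<pi> = take i \<pi> @ x # drop (Suc i) \<pi>" using id_take_nth_drop[of i \<pi>] * by simp
  moreover have "drop (Suc i) \<pi> = take (j - Suc i) (drop (Suc i) \<pi>) @ y # drop (Suc j) \<pi>"
    using id_take_nth_drop[of "j - Suc i" "drop (Suc i) \<pi>"] * by simp
  moreover have "z \<in> set (drop (Suc j) \<pi>)"
    using * by (auto simp: in_set_conv_nth intro!: exI[of _ "k - Suc j"])
  ultimately show "subseq [x, y, z] \<pi>"
    by (metis subseq_Cons2 subseq_drop_many subseq_singleton_left)
qed

lemma Av231_iff: "\<pi> \<in> Av231 n \<longleftrightarrow> \<pi> \<in> permutations_of_set {1..n} \<and> avoids_231 \<pi>"
proof -
  have "length \<pi> = n" if "\<pi> \<in> permutations_of_set {1..n}"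
    using length_finite_permutations_of_set[OF that] by simp
  then show ?thesis
    unfolding Av231_def avoids_231_def subseq_triple_iff mem_Collect_eq by metis
qed

lemma subseq_triple_append:
  assumes "subseq [x, y, z] (xs @ ys)"
  shows "subseq [x, y, z] xs \<or> subseq [x, y] xs \<and> z \<in> set ys \<or> x \<in> set xs \<and> subseq [y, z] ys \<or> subseq [x, y, z] ys"
proof -
  obtain as bs where *: "[x, y, z] = as @ bs" "subseq as xs" "subseq bs ys"
    using assms unfolding subseq_append_iff by blast
  have as: "as = take (length as) [x, y, z]" and bs: "bs = drop (length as) [x, y, z]"
    by (simp_all add: *(1))
  have "length as \<le> 3" using arg_cong[OF *(1), of length] by simp
  then consider "length as = 0" | "length as = 1" | "length as = 2" | "length as = 3" by linarith
  then show ?thesis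
  proof cases
    case 1
    then show ?thesis using *(3) bs by simp
  next
    case 2
    then have "as = [x]" "bs = [y, z]" using as bs by simp_all
    then show ?thesis using *(2,3) by (simp add: subseq_singleton_left)
  next
    case 3
    then have "as = [x, y]" "bs = [z]" using as bs by (simp_all add: numeral_2_eq_2)
    then show ?thesis using *(2,3) by (simp add: subseq_singleton_left)
  next
    case 4
    then show ?thesis using *(2) as by (simp add: numeral_3_eq_3)
  qed
qed

text \<open>
  An occurrence of 231 that meets both sides can be changed into one with the maximum \<open>n\<close> as its middle letter.
\<close>

lemma avoids_231_split:
  assumes "\<And>x. x \<in> set L \<union> set R \<Longrightarrow> x < n"
  shows "avoids_231 (L @ n # R) \<longleftrightarrow> avoids_231 L \<and> avoids_231 R \<and> (\<forall>x\<in>set L. \<forall>z\<in>set R. x \<le> z)"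
proof
  assume av: "avoids_231 (L @ n # R)"
  have "avoids_231 L" "avoids_231 R"
    using av subseq_rev_drop_many[of _ L "n # R"] subseq_drop_many[of _ "n # R" L] list_emb_Cons[of "(=)" _ R n]
    unfolding avoids_231_def by blast+
  moreover have "x \<le> z" if "x \<in> set L" "z \<in> set R" for x z
  proof (rule ccontr)
    assume "\<not> x \<le> z"
    moreover have "subseq ([x] @ [n, z]) (L @ n # R)"
      using that by (intro list_emb_append_mono) (auto simp: subseq_singleton_left)
    ultimately show False using av assms[of x] that unfolding avoids_231_def by auto
  qed
  ultimately show "avoids_231 L \<and> avoids_231 R \<and> (\<forall>x\<in>set L. \<forall>z\<in>set R. x \<le> z)" by blast
next
  assume av: "avoids_231 L \<and> avoids_231 R \<and> (\<forall>x\<in>set L. \<forall>z\<in>set R. x \<le> z)"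
  show "avoids_231 (L @ n # R)"
    unfolding avoids_231_def
  proof (intro allI impI notI)
    fix x y z assume s: "subseq [x, y, z] (L @ n # R)" and less: "z < x" "x < y"
    have *: False if "x \<in> set L" "z \<in> set (n # R)"
    proof -
      have "z \<in> set R" using that less assms[of x] by auto
      then show False using that av less by (meson not_le)
    qed
    have "x \<in> set L" if "subseq [x, y] L"
      using that by (auto dest!: list_emb_ConsD)
    moreover have "z \<in> set (n # R)" if "subseq [y, z] (n # R)"
      using subseq_Cons'[OF that] by (simp only: subseq_singleton_left)
    moreover have False if "subseq [x, y, z] (n # R)"
    proof (cases "x = n")
      case True
      then have "y \<in> set R" using that by (auto dest!: list_emb_ConsD)
      then show False using True less assms[of y] by simp
    next
      case False
      then have "subseq [x, y, z] R" using that by simp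
      then show False using av less unfolding avoids_231_def by blast
    qed
    moreover have "\<not> subseq [x, y, z] L" using av less unfolding avoids_231_def by blast
    ultimately show False using subseq_triple_append[OF s] * by blast
  qed
qed

lemma permutations_of_setD:
  assumes "\<pi> \<in> permutations_of_set {1..n}"
  shows "set \<pi> = {1..n}" "distinct \<pi>" "length \<pi> = n"
  using assms length_finite_permutations_of_set[OF assms] by (auto simp: permutations_of_set_def)

lemma avoids_231_snoc_upt:
  assumes "set \<sigma> \<subseteq> {..n}"
  shows "avoids_231 (\<sigma> @ [Suc n..<Suc (n + l)]) \<longleftrightarrow> avoids_231 \<sigma>"
proof (induction l)
  case (Suc l)
  have "avoids_231 ((\<sigma> @ [Suc n..<Suc (n + l)]) @ Suc (n + l) # []) \<longleftrightarrow> avoids_231 (\<sigma> @ [Suc n..<Suc (n + l)])"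
  proof (subst avoids_231_split)
    show "x < Suc (n + l)" if "x \<in> set (\<sigma> @ [Suc n..<Suc (n + l)]) \<union> set []" for x
      using that assms by auto
  qed (simp add: avoids_231_def)
  then show ?case using Suc by simp
qed simp

lemma tail_length_ge_iff:
  assumes "l \<le> length \<pi>"
  shows "l \<le> tail_length \<pi> \<longleftrightarrow> (\<forall>i\<in>{length \<pi> - l + 1..length \<pi>}. \<pi> ! (i - 1) = i)"
proof -
  let ?S = "{l \<in> {0..length \<pi>}. \<forall>i\<in>{length \<pi> - l + 1..length \<pi>}. \<pi> ! (i - 1) = i}"
  have "finite ?S" "0 \<in> ?S" by auto
  then have "l \<le> tail_length \<pi> \<longleftrightarrow> (\<exists>l'\<in>?S. l \<le> l')"
    unfolding tail_length_def by (intro Max_ge_iff) auto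
  also have "\<dots> \<longleftrightarrow> l \<in> ?S"
  proof
    assume "\<exists>l'\<in>?S. l \<le> l'"
    then obtain l' where l': "l' \<in> ?S" "l \<le> l'" by blast
    then have "{length \<pi> - l + 1..length \<pi>} \<subseteq> {length \<pi> - l' + 1..length \<pi>}" by auto
    then show "l \<in> ?S" using l' assms by auto
  qed auto
  finally show ?thesis using assms by simp
qed

lemma D_ge_eq: "D_ge l n = (\<lambda>\<sigma>. \<sigma> @ [Suc n..<Suc (n + l)]) ` Av231 n"
proof (intro equalityI subsetI)
  fix \<pi> assume "\<pi> \<in> D_ge l n"
  then have \<pi>: "\<pi> \<in> permutations_of_set {1..n + l}" "avoids_231 \<pi>" and tl: "l \<le> tail_length \<pi>"
    by (auto simp: D_ge_def Av231_iff)
  note p = permutations_of_setD[OF \<pi>(1)]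
  have fix_tail: "\<pi> ! (i - 1) = i" if "i \<in> {n + 1..n + l}" for i
    using tail_length_ge_iff[of l \<pi>] tl p(3) that by simp
  have "drop n \<pi> = [Suc n..<Suc (n + l)]"
  proof (rule nth_equalityI)
    fix i assume "i < length (drop n \<pi>)"
    then show "drop n \<pi> ! i = [Suc n..<Suc (n + l)] ! i"
      using fix_tail[of "Suc (n + i)"] p(3) by (simp del: upt_Suc)
  qed (simp add: p(3))
  then have split: "\<pi> = take n \<pi> @ [Suc n..<Suc (n + l)]" by (metis append_take_drop_id)
  have dist: "distinct (take n \<pi> @ [Suc n..<Suc (n + l)])" using p(2) split by simp
  have un: "set (take n \<pi>) \<union> {Suc n..<Suc (n + l)} = {1..n + l}"
    using p(1) arg_cong[OF split, of set] by (simp del: upt_Suc)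
  have disj: "set (take n \<pi>) \<inter> {Suc n..<Suc (n + l)} = {}" using dist by (simp del: upt_Suc)
  have "set (take n \<pi>) = {1..n + l} - {Suc n..<Suc (n + l)}" using un disj by blast
  also have "\<dots> = {1..n}" by auto
  finally have set: "set (take n \<pi>) = {1..n}" .
  then have "take n \<pi> \<in> Av231 n"
    using dist \<pi>(2) avoids_231_snoc_upt[of "take n \<pi>" n l] split
    by (auto simp: Av231_iff permutations_of_set_def)
  then show "\<pi> \<in> (\<lambda>\<sigma>. \<sigma> @ [Suc n..<Suc (n + l)]) ` Av231 n" using split by blast
next
  fix \<pi> assume "\<pi> \<in> (\<lambda>\<sigma>. \<sigma> @ [Suc n..<Suc (n + l)]) ` Av231 n"
  then obtain \<sigma> where \<sigma>: "\<sigma> \<in> permutations_of_set {1..n}" "avoids_231 \<sigma>"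
    and \<pi>: "\<pi> = \<sigma> @ [Suc n..<Suc (n + l)]" by (auto simp: Av231_iff)
  note p = permutations_of_setD[OF \<sigma>(1)]
  have len: "length \<pi> = n + l" by (simp add: \<pi> p(3) del: upt_Suc)
  have "\<pi> \<in> permutations_of_set {1..n + l}"
    using p by (auto simp: \<pi> permutations_of_set_def)
  moreover have "avoids_231 \<pi>" unfolding \<pi> using avoids_231_snoc_upt[of \<sigma> n l] \<sigma>(2) p(1) by auto
  moreover have "\<pi> ! (i - 1) = i" if "i \<in> {n + 1..n + l}" for i
    using that by (auto simp: \<pi> nth_append p(3) simp del: upt_Suc)
  ultimately show "\<pi> \<in> D_ge l n"
    by (simp add: D_ge_def Av231_iff tail_length_ge_iff len)
qed

lemma interval_split:
  fixes A B :: "nat set"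
  assumes "A \<union> B = {1..N}" "A \<inter> B = {}" "\<And>x y. x \<in> A \<Longrightarrow> y \<in> B \<Longrightarrow> x \<le> y"
  shows "A = {1..card A}" "B = {card A + 1..N}"
proof -
  have fin: "finite A" using assms(1) by (metis finite_Un finite_atLeastAtMost)
  define k where "k = Max (insert 0 A)"
  have le: "x \<le> k" if "x \<in> A" for x using fin that by (simp add: k_def)
  have kA: "k \<in> A" if "k \<noteq> 0" using Max_in[of "insert 0 A"] fin that by (auto simp: k_def)
  have "A = {1..k}"
  proof (intro equalityI subsetI)
    fix x assume "x \<in> A"
    moreover from this have "x \<in> {1..N}" using assms(1) by blast
    ultimately show "x \<in> {1..k}" using le by simp
  next
    fix x assume x: "x \<in> {1..k}"
    then have k: "k \<in> A" using kA by simp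
    then have "k \<in> {1..N}" using assms(1) by blast
    then have "x \<in> A \<union> B" using x assms(1) by simp
    moreover have "x \<notin> B"
    proof
      assume "x \<in> B"
      then have "k \<le> x" using assms(3) k by blast
      then show False using \<open>x \<in> B\<close> k x assms(2) by auto
    qed
    ultimately show "x \<in> A" by blast
  qed
  then have k: "A = {1..k}" "card A = k" by simp_all
  then show "A = {1..card A}" by simp
  have "B = {1..N} - A" using assms(1,2) by blast
  also have "\<dots> = {k + 1..N}" unfolding k(1) by auto
  finally show "B = {card A + 1..N}" unfolding k(2) .
qed

lemma avoids_231_nth:
  "avoids_231 \<pi> \<longleftrightarrow> (\<forall>i j k. i < j \<longrightarrow> j < k \<longrightarrow> k < length \<pi> \<longrightarrow> \<pi> ! k < \<pi> ! i \<longrightarrow> \<not> \<pi> ! i < \<pi> ! j)"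
  unfolding avoids_231_def subseq_triple_iff by blast

lemma avoids_231_map:
  assumes "strict_mono g"
  shows "avoids_231 (map g \<pi>) \<longleftrightarrow> avoids_231 \<pi>"
  by (simp add: avoids_231_nth strict_mono_less[OF assms])

text \<open>
  Splitting a permutation at its maximum is a bijection. As all letters on the left are below all letters on the
  right, the left part is a permutation of an initial segment, and the right part is a shifted permutation.
\<close>

lemma sum_Av231_Suc:
  "sum g (Av231 (Suc N)) =
    (\<Sum>a\<le>N. \<Sum>L\<in>Av231 a. \<Sum>R\<in>Av231 (N - a). g (L @ Suc N # map ((+) a) R))"
proof -
  have fin: "finite (Av231 n)" for n
    by (rule finite_subset[of _ "permutations_of_set {1..n}"]) (auto simp: Av231_iff)
  let ?D = "SIGMA a:{..N}. Av231 a \<times> Av231 (N - a)"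
  let ?h = "\<lambda>(a, L, R). L @ Suc N # map ((+) a) R"
  have mono: "strict_mono ((+) a)" for a :: nat by (simp add: strict_mono_def)
  have inj: "inj_on ?h ?D"
  proof (rule inj_onI, clarsimp)
    fix a L R a' L' R'
    assume *: "L \<in> Av231 a" "L' \<in> Av231 a'" "a \<le> N" "a' \<le> N" and
      eq: "L @ Suc N # map ((+) a) R = L' @ Suc N # map ((+) a') R'"
    have L: "set L = {1..a}" "length L = a" "set L' = {1..a'}" "length L' = a'"
      using * permutations_of_setD by (auto simp: Av231_iff)
    then have "Suc N \<notin> set L" "Suc N \<notin> set L'" using *(3,4) by auto
    with eq have "L = L'" "map ((+) a) R = map ((+) a') R'"
      by (auto simp: append_eq_append_conv2 append_eq_Cons_conv Cons_eq_append_conv)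
    moreover from this have "a = a'" using L by simp
    ultimately show "a = a' \<and> L = L' \<and> R = R'" by (auto simp: inj_map_eq_map)
  qed
  have img: "?h ` ?D = Av231 (Suc N)"
  proof (intro equalityI subsetI)
    fix \<sigma> assume "\<sigma> \<in> ?h ` ?D"
    then obtain a L R where aLR: "a \<le> N" "L \<in> Av231 a" "R \<in> Av231 (N - a)"
      and \<sigma>: "\<sigma> = L @ Suc N # map ((+) a) R" by auto
    have L: "set L = {1..a}" "distinct L" "avoids_231 L" and R: "set R = {1..N - a}" "distinct R" "avoids_231 R"
      using aLR permutations_of_setD by (auto simp: Av231_iff)
    have R': "set (map ((+) a) R) = {a + 1..N}" using R(1) aLR(1) by (simp add: image_add_atLeastAtMost)
    have "avoids_231 \<sigma>" unfolding \<sigma>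
    proof (subst avoids_231_split)
      show "x < Suc N" if "x \<in> set L \<union> set (map ((+) a) R)" for x
        using that unfolding L(1) R' using aLR(1) by auto
    qed (use L R R' avoids_231_map[OF mono] in auto)
    moreover have "set \<sigma> = {1..Suc N}"
    proof -
      have "set \<sigma> = {1..a} \<union> {Suc N} \<union> {a + 1..N}" using L(1) R' by (auto simp: \<sigma>)
      also have "\<dots> = {1..Suc N}" using aLR(1) by auto
      finally show ?thesis .
    qed
    moreover have "distinct \<sigma>"
    proof -
      have "distinct (map ((+) a) R)" using R(2) by (simp add: distinct_map)
      then show ?thesis unfolding \<sigma> distinct_append distinct.simps list.set(2) using L R' aLR(1) by auto
    qed
    ultimately show "\<sigma> \<in> Av231 (Suc N)" by (simp add: Av231_iff permutations_of_set_def)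
  next
    fix \<sigma> assume "\<sigma> \<in> Av231 (Suc N)"
    then have \<sigma>: "set \<sigma> = {1..Suc N}" "distinct \<sigma>" "avoids_231 \<sigma>"
      using permutations_of_setD by (auto simp: Av231_iff)
    then have "Suc N \<in> set \<sigma>" by simp
    then obtain L R where LR: "\<sigma> = L @ Suc N # R" by (meson split_list)
    have "Suc N \<notin> set L" "Suc N \<notin> set R" "set L \<inter> set R = {}" "distinct L" "distinct R"
      using \<sigma>(2) by (auto simp: LR)
    moreover have "insert (Suc N) (set L \<union> set R) = insert (Suc N) {1..N}"
    proof -
      have "insert (Suc N) (set L \<union> set R) = set \<sigma>" by (simp add: LR)
      also have "\<dots> = insert (Suc N) {1..N}" unfolding \<sigma>(1) by (rule atLeastAtMostSuc_conv) simp
      finally show ?thesis .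
    qed
    ultimately have un: "set L \<union> set R = {1..N}"
      using insert_ident[of "Suc N" "set L \<union> set R" "{1..N}"] by simp
    then have "x < Suc N" if "x \<in> set L \<union> set R" for x using that by auto
    then have av: "avoids_231 L" "avoids_231 R" "\<And>x y. x \<in> set L \<Longrightarrow> y \<in> set R \<Longrightarrow> x \<le> y"
      using \<sigma>(3) avoids_231_split[of L R "Suc N"] LR by auto
    define a where "a = card (set L)"
    note ab = interval_split[OF un \<open>set L \<inter> set R = {}\<close> av(3), folded a_def]
    have "a \<le> N" using card_mono[of "{1..N}" "set L"] un by (auto simp: a_def)
    define R' where "R' = map (\<lambda>x. x - a) R"
    have RR': "R = map ((+) a) R'"
      unfolding R'_def map_map using ab(2) by (intro map_idI[symmetric]) auto
    have "set R' = {1..N - a}"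
    proof -
      have "(+) a ` set R' = (+) a ` {1..N - a}"
        using ab(2) \<open>a \<le> N\<close> by (simp add: image_add_atLeastAtMost flip: RR' set_map)
      then show ?thesis
        using inj_image_eq_iff[of "(+) a" "set R'" "{1..N - a}"] by (simp only: inj_on_add)
    qed
    moreover have "distinct R'" using \<open>distinct R\<close> unfolding RR' by (simp add: distinct_map)
    moreover have "avoids_231 R'" using av(2) unfolding RR' by (simp add: avoids_231_map[OF mono])
    ultimately have "R' \<in> Av231 (N - a)" by (simp add: Av231_iff permutations_of_set_def)
    moreover have "L \<in> Av231 a" using ab(1) \<open>distinct L\<close> av(1) by (simp add: Av231_iff permutations_of_set_def)
    ultimately show "\<sigma> \<in> ?h ` ?D" using \<open>a \<le> N\<close> LR RR' by (intro image_eqI[of _ _ "(a, L, R')"]) auto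
  qed
  have "sum g (Av231 (Suc N)) = (\<Sum>p\<in>?D. g (?h p))"
    unfolding img[symmetric] by (simp add: sum.reindex[OF inj] o_def)
  also have "\<dots> = (\<Sum>a\<le>N. \<Sum>L\<in>Av231 a. \<Sum>R\<in>Av231 (N - a). g (L @ Suc N # map ((+) a) R))"
    by (simp add: sum.Sigma fin sum.cartesian_product split_def)
  finally show ?thesis .
qed

lemma Av231_0: "Av231 0 = {[]}"
  by (auto simp: Av231_iff avoids_231_def)

section \<open>The recursion and the functional equation\<close>

text \<open>
  The series \<open>g(y)\<close> seen as a series in \<open>y\<close> whose coefficients do not depend on \<open>z\<close>.
\<close>

definition const_coeffs :: "'a::zero fps \<Rightarrow> 'a fps fps" where
  "const_coeffs g = Abs_fps (\<lambda>l. fps_const (g $ l))"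

lemma finite_trees_reading: "finite (trees_reading \<T> \<pi>)" for \<T> :: "'c::finite tree set"
proof (rule finite_imageD[OF _ inj_on_skel])
  have "skel ` trees_reading \<T> \<pi> \<subseteq> {T \<in> \<T>. size T = length \<pi>}"
    by (auto simp: trees_reading_def)
  then show "finite (skel ` trees_reading \<T> \<pi>)" by (rule finite_subset) (rule finite_G_index)
qed

text \<open>
  The coefficient of \<open>z\<^sup>n y\<^sup>l\<close> in \<open>I\<close>.
\<close>

definition tail_weight :: "'c tree set \<Rightarrow> ('c tree \<Rightarrow> 'a::comm_ring_1) \<Rightarrow> nat \<Rightarrow> nat \<Rightarrow> 'a" where
  "tail_weight \<T> wt l n = (\<Sum>\<sigma>\<in>Av231 n. reading_weight \<T> wt (\<sigma> @ [Suc n..<Suc (n + l)]))"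

lemma tail_weight_0: "tail_weight \<T> wt l 0 = (\<Sum>s\<in>{s \<in> \<T>. size s = l}. wt s)"
  by (simp add: tail_weight_def Av231_0 reading_weight_sorted del: upt_Suc)

text \<open>
  The hooks of the descent at the maximum \<open>N + 1\<close> of the part before the tail. The descent top goes to the left piece, where it
  becomes a part of the tail; this is why the tails of the pieces have lengths \<open>l - i\<close> and \<open>i\<close>, adding up to \<open>l\<close>,
  although one label of the tail is used for the inserted vertex.
\<close>

lemma reading_weight_descent:
  fixes wt :: "'c::finite tree \<Rightarrow> 'a::comm_ring_1"
  assumes T: "troupe black \<T>"
    and wt: "\<And>T1 T2 v. T1 \<noteq> Leaf \<Longrightarrow> T2 \<noteq> Leaf \<Longrightarrow> v \<in> vertices T1 \<Longrightarrow>
      wt (insertion black v T1 T2) = wt T1 * wt T2"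
    and a: "a < N" and L: "L \<in> Av231 a" and R: "R \<in> Av231 (N - a)"
  shows "reading_weight \<T> wt ((L @ Suc N # map ((+) a) R) @ [Suc (Suc N)..<Suc (Suc N + l)]) =
    (\<Sum>i<l. reading_weight \<T> wt (L @ [Suc a..<Suc (a + (l - i))]) *
      reading_weight \<T> wt (R @ [Suc (N - a)..<Suc (N - a + i)]))"
proof -
  note pL = permutations_of_setD[of L a] and pR = permutations_of_setD[of R "N - a"]
  have L': "set L = {1..a}" "distinct L" and R': "set R = {1..N - a}" "distinct R"
    using L R pL pR by (auto simp: Av231_iff)
  let ?c = "[Suc (Suc N)..<Suc (Suc N + l)]" and ?R = "map ((+) a) R"
  have sR: "set ?R = {a + 1..N}" using R'(1) a by (simp add: image_add_atLeastAtMost)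
  have "reading_weight \<T> wt (L @ Suc N # ?R @ ?c) = (\<Sum>i<length ?c.
      reading_weight \<T> wt (L @ Suc N # drop (Suc i) ?c) * reading_weight \<T> wt (?R @ take i ?c))"
  proof (rule reading_weight_hooks[OF T])
    show "set L \<inter> set ?R = {}" unfolding L'(1) sR by auto
    show "?R \<noteq> []" using R'(1) a by auto
    show "x < Suc N" if "x \<in> set L \<union> set ?R" for x using that a unfolding L'(1) sR by auto
  qed (use L' R' in \<open>auto simp: distinct_map wt finite_trees_reading simp del: upt_Suc\<close>)
  also have "\<dots> = (\<Sum>i<l. reading_weight \<T> wt (L @ [Suc a..<Suc (a + (l - i))]) *
      reading_weight \<T> wt (R @ [Suc (N - a)..<Suc (N - a + i)]))"
  proof (intro sum.cong arg_cong2[where f = "(*)"])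
    fix i assume "i \<in> {..<l}"
    then have i: "i < l" by simp
    \<comment> \<open>The letters of the left piece skip \<open>R\<close> and the labels of the tail up to that of the inserted vertex.\<close>
    define g where "g x = (if x \<le> a then x else if x = Suc a then Suc N else x + (N + Suc i - a))" for x
    have "strict_mono g" using a by (auto simp: strict_mono_def g_def)
    moreover have "map g (L @ [Suc a..<Suc (a + (l - i))]) = L @ Suc N # drop (Suc i) ?c"
    proof -
      have "map g L = L" using L'(1) by (intro map_idI) (simp add: g_def)
      moreover have "map g [Suc a..<Suc (a + (l - i))] = Suc N # drop (Suc i) ?c"
        using i a by (intro nth_equalityI) (auto simp: g_def nth_Cons' simp del: upt_Suc)
      ultimately show ?thesis by simp
    qed
    ultimately show "reading_weight \<T> wt (L @ Suc N # drop (Suc i) ?c) =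
        reading_weight \<T> wt (L @ [Suc a..<Suc (a + (l - i))])"
      by (metis reading_weight_map)
    \<comment> \<open>The letters of the right piece skip \<open>L\<close> and the label \<open>N + 1\<close>.\<close>
    define h where "h x = (if x \<le> N - a then a + x else a + x + 1)" for x
    have "strict_mono h" by (auto simp: strict_mono_def h_def)
    moreover have "map h (R @ [Suc (N - a)..<Suc (N - a + i)]) = ?R @ take i ?c"
    proof -
      have "map h R = ?R" using R'(1) by (intro map_cong) (auto simp: h_def)
      moreover have "map h [Suc (N - a)..<Suc (N - a + i)] = take i ?c"
        using i a by (intro nth_equalityI) (auto simp: h_def simp del: upt_Suc)
      ultimately show ?thesis by simp
    qed
    ultimately show "reading_weight \<T> wt (?R @ take i ?c) =
        reading_weight \<T> wt (R @ [Suc (N - a)..<Suc (N - a + i)])"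
      by (metis reading_weight_map)
  qed (simp del: upt_Suc)
  finally show ?thesis by simp
qed

text \<open>
  The case of an empty right part is separate: the maximum is no descent then, but prolongs the tail.
\<close>

lemma tail_weight_Suc:
  fixes wt :: "'c::finite tree \<Rightarrow> 'a::comm_ring_1"
  assumes T: "troupe black \<T>"
    and wt: "\<And>T1 T2 v. T1 \<noteq> Leaf \<Longrightarrow> T2 \<noteq> Leaf \<Longrightarrow> v \<in> vertices T1 \<Longrightarrow>
      wt (insertion black v T1 T2) = wt T1 * wt T2"
  shows "tail_weight \<T> wt l (Suc N) = tail_weight \<T> wt (Suc l) N +
    (\<Sum>a<N. \<Sum>i<l. tail_weight \<T> wt (l - i) a * tail_weight \<T> wt i (N - a))"
proof -
  let ?W = "reading_weight \<T> wt"
  have "tail_weight \<T> wt l (Suc N) = (\<Sum>a\<le>N. \<Sum>L\<in>Av231 a. \<Sum>R\<in>Av231 (N - a).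
      ?W ((L @ Suc N # map ((+) a) R) @ [Suc (Suc N)..<Suc (Suc N + l)]))"
    unfolding tail_weight_def sum_Av231_Suc ..
  also have "{..N} = insert N {..<N}" by auto
  also have "(\<Sum>a\<in>insert N {..<N}. \<Sum>L\<in>Av231 a. \<Sum>R\<in>Av231 (N - a).
        ?W ((L @ Suc N # map ((+) a) R) @ [Suc (Suc N)..<Suc (Suc N + l)])) =
      (\<Sum>L\<in>Av231 N. ?W ((L @ [Suc N]) @ [Suc (Suc N)..<Suc (Suc N + l)])) +
      (\<Sum>a<N. \<Sum>L\<in>Av231 a. \<Sum>R\<in>Av231 (N - a).
        ?W ((L @ Suc N # map ((+) a) R) @ [Suc (Suc N)..<Suc (Suc N + l)]))"
    by (simp add: Av231_0 del: upt_Suc)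
  also have "(\<Sum>L\<in>Av231 N. ?W ((L @ [Suc N]) @ [Suc (Suc N)..<Suc (Suc N + l)])) = tail_weight \<T> wt (Suc l) N"
    by (simp add: tail_weight_def upt_conv_Cons[of "Suc N"] del: upt_Suc)
  also have "(\<Sum>a<N. \<Sum>L\<in>Av231 a. \<Sum>R\<in>Av231 (N - a).
        ?W ((L @ Suc N # map ((+) a) R) @ [Suc (Suc N)..<Suc (Suc N + l)])) =
      (\<Sum>a<N. \<Sum>i<l. tail_weight \<T> wt (l - i) a * tail_weight \<T> wt i (N - a))"
  proof (intro sum.cong refl)
    fix a assume "a \<in> {..<N}"
    then have a: "a < N" by simp
    have "(\<Sum>L\<in>Av231 a. \<Sum>R\<in>Av231 (N - a).
          ?W ((L @ Suc N # map ((+) a) R) @ [Suc (Suc N)..<Suc (Suc N + l)])) =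
        (\<Sum>L\<in>Av231 a. \<Sum>R\<in>Av231 (N - a). \<Sum>i<l. ?W (L @ [Suc a..<Suc (a + (l - i))]) *
          ?W (R @ [Suc (N - a)..<Suc (N - a + i)]))"
      by (intro sum.cong refl reading_weight_descent[OF T wt a])
    also have "\<dots> = (\<Sum>i<l. \<Sum>L\<in>Av231 a. \<Sum>R\<in>Av231 (N - a). ?W (L @ [Suc a..<Suc (a + (l - i))]) *
          ?W (R @ [Suc (N - a)..<Suc (N - a + i)]))"
      by (simp only: sum.swap[of _ "{..<l}"])
    finally show "(\<Sum>L\<in>Av231 a. \<Sum>R\<in>Av231 (N - a).
          ?W ((L @ Suc N # map ((+) a) R) @ [Suc (Suc N)..<Suc (Suc N + l)])) =
        (\<Sum>i<l. tail_weight \<T> wt (l - i) a * tail_weight \<T> wt i (N - a))"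
      by (simp add: tail_weight_def sum_product del: upt_Suc)
  qed
  finally show ?thesis .
qed

lemma I_series_nth: "I_series \<T> r f $ l $ n = tail_weight \<T> (weight r f) l n"
  for \<T> :: "'c::finite tree set"
proof -
  have D: "\<pi> \<in> permutations_of_set {1..n + l}" if "\<pi> \<in> D_ge l n" for \<pi>
    using that by (auto simp: D_ge_def Av231_def)
  have "postorder_reading -` D_ge l n \<inter> decreasing_trees \<T> =
      (\<Union>\<pi>\<in>D_ge l n. postorder_reading -` {\<pi>} \<inter> decreasing_trees \<T>)" by auto
  also have "\<dots> = (\<Union>\<pi>\<in>D_ge l n. trees_reading \<T> \<pi>)"
    by (intro SUP_cong refl decreasing_trees_reading[OF D])
  finally have un: "postorder_reading -` D_ge l n \<inter> decreasing_trees \<T> = (\<Union>\<pi>\<in>D_ge l n. trees_reading \<T> \<pi>)" .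
  have "finite (D_ge l n)" by (rule finite_subset[OF subsetI[OF D]]) simp_all
  then have "I_series \<T> r f $ l $ n = (\<Sum>\<pi>\<in>D_ge l n. reading_weight \<T> (weight r f) \<pi>)"
    unfolding I_series_def fps_nth_Abs_fps un reading_weight_def
    by (intro sum.UNION_disjoint ballI impI finite_trees_reading) (auto simp: trees_reading_def)
  also have "\<dots> = tail_weight \<T> (weight r f) l n"
    unfolding D_ge_eq tail_weight_def
    by (subst sum.reindex) (auto simp: inj_on_def simp del: upt_Suc)
  finally show ?thesis .
qed

lemma xpow_add: "xpow i (a + b) = xpow i a * xpow i b"
proof -
  have "Cexponent (a + b) = Cexponent a + Cexponent b" by (simp add: plus_cexponent_def)
  then show ?thesis
    by (simp add: xpow_def mult_single single_add flip: to_fract_mult)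
qed

lemma weight_insertion:
  assumes "\<And>i. i < r \<Longrightarrow> insertion_additive black (f i)"
    and "T1 \<noteq> Leaf" "T2 \<noteq> Leaf" "v \<in> vertices T1"
  shows "weight r f (insertion black v T1 T2) = weight r f T1 * weight r f T2"
  using assms by (auto simp: weight_def insertion_additive_def xpow_add simp flip: prod.distrib intro!: prod.cong)

text \<open>
  This is \<open>tail_weight_Suc\<close> in terms of series. The convolution runs over all indices, whereas the
  recursion omits the tail length \<open>0\<close> in the first factor and the size \<open>0\<close> in the second. Subtracting
  \<open>I $ 0\<close> and \<open>G\<close> removes exactly these terms.
\<close>

lemma I_series_functional_equation:
  fixes \<T> :: "'c::finite tree set"
  assumes T: "troupe black \<T>" and f: "\<And>i. i < r \<Longrightarrow> insertion_additive black (f i)"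
  defines "I \<equiv> I_series \<T> r f" and "G \<equiv> const_coeffs (G_series \<T> r f)"
  shows "fps_X * (I - G) = fps_const fps_X * (I - fps_const (I $ 0)) * (1 + fps_X * (I - G))"
proof (rule fps_ext)
  fix k
  let ?F = "fps_const (I $ 0)"
  let ?A = "tail_weight \<T> (weight r f)"
  have I: "I $ l $ n = ?A l n" for l n by (simp add: I_def I_series_nth)
  have G: "G $ l = fps_const (?A l 0)" for l
    by (simp add: G_def const_coeffs_def G_series_def tail_weight_0)
  note rec = tail_weight_Suc[OF T weight_insertion[OF f]]
  have RHS: "fps_const fps_X * (I - ?F) * (1 + fps_X * (I - G)) =
      fps_const fps_X * ((I - ?F) + fps_X * ((I - ?F) * (I - G)))" by (simp add: algebra_simps)
  show "(fps_X * (I - G)) $ k = (fps_const fps_X * (I - ?F) * (1 + fps_X * (I - G))) $ k"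
  proof (cases k)
    case 0
    then show ?thesis by (simp add: RHS)
  next
    case (Suc l)
    have "(I - G) $ l = fps_X * (I $ Suc l + ((I - ?F) * (I - G)) $ l)"
    proof (rule fps_ext)
      fix n
      show "(I - G) $ l $ n = (fps_X * (I $ Suc l + ((I - ?F) * (I - G)) $ l)) $ n"
      proof (cases n)
        case 0
        then show ?thesis by (simp add: I G)
      next
        case (Suc N)
        have "((I - ?F) * (I - G)) $ l $ N =
            (\<Sum>j\<le>l. \<Sum>a\<le>N. (I - ?F) $ j $ a * (I - G) $ (l - j) $ (N - a))"
          by (simp add: fps_mult_nth fps_sum_nth atMost_atLeast0)
        also have "\<dots> = (\<Sum>j\<in>{..l} - {0}. \<Sum>a\<in>{..N} - {N}. (I - ?F) $ j $ a * (I - G) $ (l - j) $ (N - a))"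
          by (intro sum.mono_neutral_cong_right sum.mono_neutral_right) (auto simp: I G)
        also have "\<dots> = (\<Sum>j\<in>{..l} - {0}. \<Sum>a<N. ?A j a * ?A (l - j) (N - a))"
          by (intro sum.cong) (auto simp: I G)
        also have "\<dots> = (\<Sum>i<l. \<Sum>a<N. ?A (l - i) a * ?A i (N - a))"
          by (rule sum.reindex_bij_witness[of _ "\<lambda>i. l - i" "\<lambda>j. l - j"]) auto
        also have "\<dots> = (\<Sum>a<N. \<Sum>i<l. ?A (l - i) a * ?A i (N - a))" by (rule sum.swap)
        finally show ?thesis by (simp add: Suc I G rec)
      qed
    qed
    then show ?thesis by (simp add: Suc RHS)
  qed
qed

section \<open>Elements algebraic over a subfield\<close>

text \<open>
  These lemmas identify the operations of the carrier-based ring \<^const>\<open>ring_of_type_algebra\<close> with those of the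
  type, so that the theory of finite extensions applies to subfields of a type.
\<close>

lemma type_ring_simps [simp]:
  "carrier (ring_of_type_algebra :: 'a::ring_1 ring) = UNIV"
  "monoid.mult (ring_of_type_algebra :: 'a::ring_1 ring) = (*)"
  "monoid.one (ring_of_type_algebra :: 'a::ring_1 ring) = 1"
  "ring.zero (ring_of_type_algebra :: 'a::ring_1 ring) = 0"
  "ring.add (ring_of_type_algebra :: 'a::ring_1 ring) = (+)"
  by (simp_all add: ring_of_type_algebra_def fun_eq_iff)

lemma type_ring_a_inv [simp]: "\<ominus>\<^bsub>ring_of_type_algebra\<^esub> x = - x" for x :: "'a::comm_ring_1"
proof -
  interpret R: ring "ring_of_type_algebra :: 'a ring" ..
  show ?thesis using R.minus_equality[of "- x" x] by simp
qed

lemma type_ring_m_inv [simp]: "x \<noteq> 0 \<Longrightarrow> inv\<^bsub>ring_of_type_algebra\<^esub> x = inverse x" for x :: "'a::field"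
proof -
  assume "x \<noteq> 0"
  interpret R: field "ring_of_type_algebra :: 'a ring" ..
  show ?thesis using R.inv_unique'[of x "inverse x"] \<open>x \<noteq> 0\<close> by simp
qed

definition subfield_set :: "'a::field set \<Rightarrow> bool" where
  "subfield_set K \<longleftrightarrow> generated_subfield K = K"

lemma subfield_setD:
  assumes "subfield_set K"
  shows "0 \<in> K" "1 \<in> K" "x \<in> K \<Longrightarrow> y \<in> K \<Longrightarrow> x + y \<in> K" "x \<in> K \<Longrightarrow> y \<in> K \<Longrightarrow> x * y \<in> K"
    "x \<in> K \<Longrightarrow> - x \<in> K" "x \<in> K \<Longrightarrow> inverse x \<in> K" "x \<in> K \<Longrightarrow> y \<in> K \<Longrightarrow> x - y \<in> K"
    "x \<in> K \<Longrightarrow> y \<in> K \<Longrightarrow> x / y \<in> K" "x \<in> K \<Longrightarrow> x ^ n \<in> K"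
proof -
  note K = assms[unfolded subfield_set_def]
  note intros = generated_subfield.intros(2-)[where A = K, unfolded K]
  show "0 \<in> K" and one: "1 \<in> K" by (rule intros)+
  show add: "x + y \<in> K" if "x \<in> K" "y \<in> K" for x y using that by (rule intros)
  show mult: "x * y \<in> K" if "x \<in> K" "y \<in> K" for x y using that by (rule intros)
  show uminus: "- x \<in> K" if "x \<in> K" for x using that by (rule intros)
  show inv: "inverse x \<in> K" if "x \<in> K" for x using that by (rule intros)
  show "x - y \<in> K" if "x \<in> K" "y \<in> K" using add[OF that(1) uminus[OF that(2)]] by simp
  show "x / y \<in> K" if "x \<in> K" "y \<in> K" using mult[OF that(1) inv[OF that(2)]] by (simp add: divide_inverse)
  show "x ^ n \<in> K" if "x \<in> K" by (induction n) (auto intro: one mult that)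
qed

lemma subfield_set_iff:
  "subfield_set K \<longleftrightarrow> subfield K (ring_of_type_algebra :: 'a::field ring)"
proof -
  interpret R: field "ring_of_type_algebra :: 'a ring" ..
  show ?thesis
  proof
    assume K: "subfield_set K"
    show "subfield K (ring_of_type_algebra :: 'a ring)"
      by (rule R.subfieldI'[OF R.subringI]) (auto intro: subfield_setD[OF K])
  next
    assume K: "subfield K (ring_of_type_algebra :: 'a ring)"
    interpret K: subfield K "ring_of_type_algebra :: 'a ring" by fact
    have "x \<in> K" if "x \<in> generated_subfield K" for x
      using that
    proof induction
      case zero then show ?case using R.subring_props(2)[OF K] by simp
    next
      case one then show ?case using R.subring_props(3)[OF K] by simp
    next
      case (uminus a) then show ?case using R.subring_props(5)[OF K] by simp
    next
      case (add a b) then show ?case using R.subring_props(7)[OF K] by simp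
    next
      case (mult a b) then show ?case using R.subring_props(6)[OF K] by simp
    next
      case (inverse a) then show ?case
        using R.subfield_m_inv(1)[OF K, of a] R.subring_props(2)[OF K] by (cases "a = 0") auto
    qed auto
    then show "subfield_set K"
      unfolding subfield_set_def using generated_subfield.incl by blast
  qed
qed

lemma subfield_set_generated: "subfield_set (generated_subfield A)"
proof -
  have "x \<in> generated_subfield A" if "x \<in> generated_subfield (generated_subfield A)" for x
    using that by induction (auto intro: generated_subfield.intros(2-))
  then show ?thesis unfolding subfield_set_def using generated_subfield.incl by blast
qed

lemma eval_type_ring:
  "ring.eval ring_of_type_algebra (rev as) x = poly (Poly as) (x :: 'a::field)"
proof -
  interpret R: field "ring_of_type_algebra :: 'a ring" ..
  show ?thesis
    by (induction as) (simp_all add: R.eval_append algebra_simps)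
qed

lemma algebraic_over_iff:
  assumes "subfield_set K"
  shows "algebraic_over K x \<longleftrightarrow> (ring.algebraic (ring_of_type_algebra :: 'a::field ring) over K) x"
proof -
  interpret R: field "ring_of_type_algebra :: 'a ring" ..
  have K: "subfield K (ring_of_type_algebra :: 'a ring)"
    using assms subfield_set_iff by blast
  show ?thesis
  proof
    assume "algebraic_over K x"
    then obtain p where p: "p \<noteq> 0" "\<And>i. coeff p i \<in> K" "poly p x = 0"
      unfolding algebraic_over_def by blast
    have coeffs_in: "a \<in> K" if "a \<in> set (coeffs p)" for a
      using that p(2) by (auto simp: coeffs_def split: if_splits)
    have "rev (coeffs p) \<in> carrier (univ_poly ring_of_type_algebra K)"
      using p(1) coeffs_in by (auto simp: univ_poly_def polynomial_def hd_rev last_coeffs_eq_coeff_degree)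
    moreover have "rev (coeffs p) \<noteq> []" using p(1) by simp
    moreover have "R.eval (rev (coeffs p)) x = 0" using p(3) by (simp add: eval_type_ring)
    ultimately show "(R.algebraic over K) x" by (intro R.algebraicI) auto
  next
    assume "(R.algebraic over K) x"
    then obtain q where q: "q \<in> carrier (univ_poly ring_of_type_algebra K)" "q \<noteq> []" "R.eval q x = 0"
      using R.algebraicE[OF subfieldE(1)[OF K], of x] by auto
    have qs: "set q \<subseteq> K" "hd q \<noteq> 0" using q(1,2) by (auto simp: univ_poly_def polynomial_def)
    define p where "p = Poly (rev q)"
    have "coeff p (length q - 1) = hd q"
      using q(2) by (simp add: p_def nth_default_def rev_nth hd_conv_nth)
    then have "p \<noteq> 0" using qs by auto
    moreover have "coeff p i \<in> K" for i
      using qs(1) subfield_setD(1)[OF assms]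
      by (auto simp: p_def nth_default_def rev_nth)
    moreover have "poly p x = 0" using q(3) eval_type_ring[of "rev q" x] by (simp add: p_def)
    ultimately show "algebraic_over K x" unfolding algebraic_over_def by blast
  qed
qed

lemma algebraic_over_self:
  assumes "subfield_set K" "x \<in> K"
  shows "algebraic_over K x"
  unfolding algebraic_over_def
proof (intro exI conjI allI)
  show "coeff [:- x, 1:] i \<in> K" for i
    using subfield_setD[OF assms(1)] assms(2) by (auto simp: coeff_pCons split: nat.splits)
qed auto

lemma subfield_set_algebraic:
  assumes "subfield_set K"
  shows "subfield_set {x. algebraic_over K (x :: 'a::field)}"
proof -
  interpret R: field "ring_of_type_algebra :: 'a ring" ..
  have "subfield {x \<in> UNIV. (R.algebraic over K) x} (ring_of_type_algebra :: 'a ring)"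
    using R.subfield_of_algebraics assms by (simp add: subfield_set_iff)
  then show ?thesis
    by (simp add: subfield_set_iff algebraic_over_iff[OF assms])
qed

text \<open>
  The coefficients of an equation for \<open>x\<close> generate a finite extension \<open>L\<close> of \<open>K\<close>. Then \<open>L(x)\<close> is finite over \<open>K\<close> by the
  tower law, and elements of finite extensions are algebraic.
\<close>

lemma algebraic_over_trans:
  assumes K: "subfield_set K" and x: "algebraic_over {x. algebraic_over K x} (x :: 'a::field)"
  shows "algebraic_over K x"
proof -
  interpret R: field "ring_of_type_algebra :: 'a ring" ..
  have K': "subfield K (ring_of_type_algebra :: 'a ring)"
    using K subfield_set_iff by blast
  from x obtain p where p: "p \<noteq> 0" "\<And>i. algebraic_over K (coeff p i)" "poly p x = 0"
    unfolding algebraic_over_def[of "{x. algebraic_over K x}"] by blast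
  let ?as = "coeffs p"
  let ?L = "R.finite_extension K ?as"
  have as: "(R.algebraic over K) a" if "a \<in> set ?as" for a
    using that p(2) by (auto simp: coeffs_def algebraic_over_iff[OF K] split: if_splits)
  have L: "subfield ?L (ring_of_type_algebra :: 'a ring)"
    using R.finite_extension_is_subfield[OF K' _ as] by simp
  then have L': "subfield_set ?L" by (simp add: subfield_set_iff)
  have "set ?as \<subseteq> ?L" using R.finite_extension_mem[OF subfieldE(1)[OF K']] by simp
  then have "coeff p i \<in> ?L" for i
    using subfield_setD(1)[OF L'] by (cases "coeff p i = 0") (auto intro: coeff_in_coeffs[OF p(1)] le_degree)
  then have "algebraic_over ?L x" unfolding algebraic_over_def using p by blast
  then have xL: "(R.algebraic over ?L) x" using algebraic_over_iff[OF L'] by blast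
  have "R.finite_dimension K (R.simple_extension ?L x)"
    using R.telescopic_base_dim(1)[OF K' L R.finite_extension_finite_dimension(1)[OF K' _ as]
        R.finite_dimensionI[OF R.dimension_simple_extension[OF L _ xL]]] by simp
  then have "(R.algebraic over K) x"
    using R.finite_dimension_imp_algebraic[OF K' R.simple_extension_is_subring[OF subfieldE(1)[OF L]]]
      R.simple_extension_mem[OF subfieldE(1)[OF L]] by simp
  then show ?thesis by (simp add: algebraic_over_iff[OF K])
qed

section \<open>Algebraic power series\<close>

instance fract :: ("{idom, ring_char_0}") field_char_0
proof
  show "inj (of_nat :: nat \<Rightarrow> 'a fract)"
    by (auto simp: inj_on_def of_nat_fract eq_fract)
qed

lemma subfield_set_of_nat: "subfield_set K \<Longrightarrow> of_nat n \<in> K"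
  by (induction n) (auto intro: subfield_setD)

lemma subfield_set_sum: "subfield_set K \<Longrightarrow> (\<And>i. i \<in> A \<Longrightarrow> f i \<in> K) \<Longrightarrow> sum f A \<in> K"
  by (induction A rule: infinite_finite_induct) (auto intro: subfield_setD)

lemma algebraic_over_sumI:
  assumes K: "subfield_set K" and c: "\<And>i. i \<le> n \<Longrightarrow> c i \<in> K"
    and "j \<le> n" "c j \<noteq> 0" and eq: "(\<Sum>i\<le>n. c i * x ^ i) = 0"
  shows "algebraic_over K x"
  unfolding algebraic_over_def
proof (intro exI conjI allI)
  let ?p = "\<Sum>i\<le>n. Polynomial.monom (c i) i"
  have co: "coeff ?p i = (if i \<le> n then c i else 0)" for i
    by (simp add: coeff_sum)
  show "?p \<noteq> 0" using co[of j] assms(3,4) by force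
  show "coeff ?p i \<in> K" for i using c subfield_setD(1)[OF K] by (simp add: co)
  show "poly ?p x = 0" using eq by (simp add: poly_sum poly_monom)
qed

definition polys_over :: "'a::zero set \<Rightarrow> 'a poly set" where
  "polys_over K = {p. \<forall>i. coeff p i \<in> K}"

definition ratfun_over :: "'k::field set \<Rightarrow> 'k fps fract set" where
  "ratfun_over K = generated_subfield ((\<lambda>c. to_fract (fps_const c)) ` K \<union> {to_fract fps_X})"

lemma subfield_set_ratfun_over: "subfield_set (ratfun_over K)"
  unfolding ratfun_over_def by (rule subfield_set_generated)

lemma polys_over_closed:
  assumes K: "subfield_set (K :: 'k::field set)"
  shows "0 \<in> polys_over K" "1 \<in> polys_over K" "[:0, 1:] \<in> polys_over K"
    "c \<in> K \<Longrightarrow> [:c:] \<in> polys_over K"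
    "p \<in> polys_over K \<Longrightarrow> q \<in> polys_over K \<Longrightarrow> p + q \<in> polys_over K"
    "p \<in> polys_over K \<Longrightarrow> - p \<in> polys_over K"
    "p \<in> polys_over K \<Longrightarrow> q \<in> polys_over K \<Longrightarrow> p * q \<in> polys_over K"
    "p \<in> polys_over K \<Longrightarrow> pderiv p \<in> polys_over K"
    "c \<in> K \<Longrightarrow> p \<in> polys_over K \<Longrightarrow> smult c p \<in> polys_over K"
  using subfield_setD[OF K] subfield_set_of_nat[OF K]
  by (auto simp: polys_over_def coeff_pCons coeff_mult coeff_pderiv split: nat.splits
      intro!: subfield_set_sum[OF K] subfield_setD(4)[OF K])

lemma fps_of_poly_as_sum:
  fixes p :: "'a::comm_ring_1 poly"
  assumes "degree p \<le> n"
  shows "fps_of_poly p = (\<Sum>i\<le>n. fps_const (coeff p i) * fps_X ^ i)"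
proof -
  have "fps_of_poly (\<Sum>i\<le>n. Polynomial.monom (coeff p i) i) = (\<Sum>i\<le>n. fps_const (coeff p i) * fps_X ^ i)"
    by (simp add: fps_of_poly_sum fps_of_poly_monom)
  then show ?thesis using poly_as_sum_of_monoms'[OF assms] by simp
qed

lemma to_fract_power [simp]: "to_fract (x ^ n) = to_fract x ^ n"
  by (induction n) auto

lemma ratfun_over_poly:
  assumes "p \<in> polys_over K"
  shows "to_fract (fps_of_poly p) \<in> ratfun_over K"
  unfolding fps_of_poly_as_sum[OF order_refl] using assms
  by (auto simp: polys_over_def ratfun_over_def intro!: subfield_set_sum subfield_set_generated
      generated_subfield.mult subfield_setD(9)[OF subfield_set_generated]
      intro: generated_subfield.incl)

lemma ratfun_over_fraction:
  assumes K: "subfield_set K" and x: "x \<in> ratfun_over K"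
  shows "\<exists>p\<in>polys_over K. \<exists>q\<in>polys_over K. q \<noteq> 0 \<and> to_fract (fps_of_poly q) * x = to_fract (fps_of_poly p)"
  using x unfolding ratfun_over_def
proof induction
  case (incl a)
  then consider c where "c \<in> K" "a = to_fract (fps_const c)" | "a = to_fract fps_X" by blast
  then show ?case
  proof cases
    case (1 c)
    then show ?thesis
      by (intro bexI[of _ "[:c:]"] bexI[of _ 1]) (auto simp: fps_of_poly_const polys_over_closed[OF K])
  next
    case 2
    then show ?thesis
      by (intro bexI[of _ "[:0, 1:]"] bexI[of _ 1]) (auto simp: polys_over_closed[OF K])
  qed
next
  case zero
  then show ?case
    by (intro bexI[of _ 0] bexI[of _ 1]) (auto simp: polys_over_closed[OF K])
next
  case one
  then show ?case
    by (intro bexI[of _ 1] bexI[of _ 1]) (auto simp: polys_over_closed[OF K])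
next
  case (add a b)
  then obtain p q p' q' where "p \<in> polys_over K" "q \<in> polys_over K" "p' \<in> polys_over K" "q' \<in> polys_over K"
    "q \<noteq> 0" "q' \<noteq> 0" and *: "to_fract (fps_of_poly p) = to_fract (fps_of_poly q) * a"
    "to_fract (fps_of_poly p') = to_fract (fps_of_poly q') * b" by metis
  then show ?case
    by (intro bexI[of _ "p * q' + p' * q"] bexI[of _ "q * q'"])
      (auto simp: fps_of_poly_mult fps_of_poly_add * algebra_simps intro!: polys_over_closed[OF K])
next
  case (uminus a)
  then obtain p q where "p \<in> polys_over K" "q \<in> polys_over K"
    "q \<noteq> 0" "to_fract (fps_of_poly q) * a = to_fract (fps_of_poly p)" by metis
  then show ?case
    by (intro bexI[of _ "- p"] bexI[of _ q]) (auto simp: fps_of_poly_uminus polys_over_closed[OF K])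
next
  case (mult a b)
  then obtain p q p' q' where "p \<in> polys_over K" "q \<in> polys_over K" "p' \<in> polys_over K" "q' \<in> polys_over K"
    "q \<noteq> 0" "q' \<noteq> 0" and *: "to_fract (fps_of_poly p) = to_fract (fps_of_poly q) * a"
    "to_fract (fps_of_poly p') = to_fract (fps_of_poly q') * b" by metis
  then show ?case
    by (intro bexI[of _ "p * p'"] bexI[of _ "q * q'"])
      (auto simp: fps_of_poly_mult * algebra_simps intro!: polys_over_closed[OF K])
next
  case (inverse a)
  then obtain p q where pq: "p \<in> polys_over K" "q \<in> polys_over K"
    "q \<noteq> 0" "to_fract (fps_of_poly p) = to_fract (fps_of_poly q) * a" by metis
  show ?case
  proof (cases "p = 0")
    case True
    then have "a = 0" using pq fps_of_poly_eq_iff[of q 0] by simp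
    then show ?thesis
      by (intro bexI[of _ 0] bexI[of _ 1]) (auto simp: polys_over_closed[OF K])
  next
    case False
    then have "a \<noteq> 0" using pq fps_of_poly_eq_iff[of p 0] by auto
    then show ?thesis using False pq
      by (intro bexI[of _ q] bexI[of _ p]) auto
  qed
qed

lemma ratfun_over_common_denominator:
  assumes K: "subfield_set K" and "finite S" "S \<subseteq> ratfun_over K"
  shows "\<exists>q\<in>polys_over K. q \<noteq> 0 \<and>
    (\<forall>x\<in>S. \<exists>p\<in>polys_over K. to_fract (fps_of_poly q) * x = to_fract (fps_of_poly p))"
  using assms(2,3)
proof (induction rule: finite_induct)
  case empty
  then show ?case by (intro bexI[of _ 1]) (auto simp: polys_over_closed[OF K])
next
  case (insert x S)
  obtain q where q: "q \<in> polys_over K" "q \<noteq> 0"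
    "\<And>x. x \<in> S \<Longrightarrow> \<exists>p\<in>polys_over K. to_fract (fps_of_poly q) * x = to_fract (fps_of_poly p)"
    using insert by auto
  obtain p' q' where p': "p' \<in> polys_over K" "q' \<in> polys_over K" "q' \<noteq> 0"
    "to_fract (fps_of_poly q') * x = to_fract (fps_of_poly p')"
    using ratfun_over_fraction[OF K] insert.prems by blast
  have "\<exists>p\<in>polys_over K. to_fract (fps_of_poly (q * q')) * y = to_fract (fps_of_poly p)"
    if "y \<in> insert x S" for y
  proof (cases "y = x")
    case True
    then show ?thesis using p' q(1)
      by (intro bexI[of _ "q * p'"]) (auto simp: fps_of_poly_mult intro!: polys_over_closed[OF K])
  next
    case False
    with that q(3) obtain p where "p \<in> polys_over K" "to_fract (fps_of_poly q) * y = to_fract (fps_of_poly p)" by blast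
    then show ?thesis using p'
      by (intro bexI[of _ "q' * p"]) (auto simp: fps_of_poly_mult intro!: polys_over_closed[OF K])
  qed
  then show ?case using q p'
    by (intro bexI[of _ "q * q'"]) (auto intro!: polys_over_closed[OF K])
qed

text \<open>
  Clearing denominators gives an equation between power series, so that homomorphisms between rings of power series,
  composition and termwise differentiation can be applied to it.
\<close>

lemma ratfun_algebraicE:
  assumes K: "subfield_set K" and "algebraic_over (ratfun_over K) (to_fract g)"
  obtains c n where "\<And>i. c i \<in> polys_over K" "c n \<noteq> 0" "(\<Sum>i\<le>n. fps_of_poly (c i) * g ^ i) = 0"
proof -
  obtain p where p: "p \<noteq> 0" "\<And>i. coeff p i \<in> ratfun_over K" "poly p (to_fract g) = 0"
    using assms(2) unfolding algebraic_over_def by blast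
  define n where "n = degree p"
  obtain q where q: "q \<in> polys_over K" "q \<noteq> 0"
    "\<And>i. i \<le> n \<Longrightarrow> \<exists>p'\<in>polys_over K. to_fract (fps_of_poly q) * coeff p i = to_fract (fps_of_poly p')"
    using ratfun_over_common_denominator[OF K, of "coeff p ` {..n}"] p(2) by (auto simp: image_subset_iff)
  then obtain c where c: "\<And>i. i \<le> n \<Longrightarrow> c i \<in> polys_over K"
    "\<And>i. i \<le> n \<Longrightarrow> to_fract (fps_of_poly q) * coeff p i = to_fract (fps_of_poly (c i))" by metis
  have "to_fract (\<Sum>i\<le>n. fps_of_poly (c i) * g ^ i) = to_fract (fps_of_poly q) * poly p (to_fract g)"
    unfolding poly_altdef n_def[symmetric] sum_distrib_left to_fract_sum
    by (intro sum.cong refl) (auto simp flip: c(2))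
  then have "(\<Sum>i\<le>n. fps_of_poly (c i) * g ^ i) = 0" unfolding p(3) by (simp only: to_fract_eq_0_iff mult_zero_right)
  moreover have "c n \<noteq> 0"
  proof
    assume "c n = 0"
    then have "to_fract (fps_of_poly q) * coeff p n = 0" using c(2)[of n] by simp
    then show False using q(2) fps_of_poly_eq_iff[of q 0] p(1) by (simp add: n_def)
  qed
  ultimately show ?thesis
    using that[of "\<lambda>i. if i \<le> n then c i else 0" n] c(1) polys_over_closed(1)[OF K] by auto
qed

text \<open>
  Used for substitutions into a power series and for the two embeddings of series in one variable into
  the series in \<open>z\<close> and \<open>y\<close>.
\<close>

lemma algebraic_over_transfer:
  fixes h :: "'k::field fps \<Rightarrow> 'b::idom"
  assumes K: "subfield_set K" and g: "algebraic_over (ratfun_over K) (to_fract g)"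
    and add: "\<And>a b. h (a + b) = h a + h b" and mult: "\<And>a b. h (a * b) = h a * h b"
    and one: "h 1 = 1" and inj: "\<And>a. h a = 0 \<Longrightarrow> a = 0"
    and L: "subfield_set L" and const: "\<And>c. c \<in> K \<Longrightarrow> to_fract (h (fps_const c)) \<in> L"
    and X: "to_fract (h fps_X) \<in> L"
  shows "algebraic_over L (to_fract (h g))"
proof -
  have h0: "h 0 = 0" using add[of 0 0] by (metis add.right_neutral add_left_cancel)
  have hsum: "h (sum f A) = (\<Sum>x\<in>A. h (f x))" for f :: "nat \<Rightarrow> 'k fps" and A
    by (induction A rule: infinite_finite_induct) (auto simp: h0 add)
  have hpow: "h (x ^ n) = h x ^ n" for x n by (induction n) (auto simp: one mult)
  obtain c n where c: "\<And>i. c i \<in> polys_over K" "c n \<noteq> 0" "(\<Sum>i\<le>n. fps_of_poly (c i) * g ^ i) = 0"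
    using ratfun_algebraicE[OF K g] by metis
  have hL: "to_fract (h (fps_of_poly p)) \<in> L" if "p \<in> polys_over K" for p
    unfolding fps_of_poly_as_sum[OF order_refl] hsum mult hpow using that
    by (auto simp: polys_over_def intro!: subfield_set_sum[OF L] subfield_setD(4,9)[OF L] const X)
  show ?thesis
  proof (rule algebraic_over_sumI[OF L, where c = "\<lambda>i. to_fract (h (fps_of_poly (c i)))" and n = n and j = n])
    show "to_fract (h (fps_of_poly (c n))) \<noteq> 0"
      using c(2) inj[of "fps_of_poly (c n)"] fps_of_poly_eq_iff[of "c n" 0] by auto
    have "h (\<Sum>i\<le>n. fps_of_poly (c i) * g ^ i) = 0" by (simp add: c(3) h0)
    then have "to_fract (\<Sum>i\<le>n. h (fps_of_poly (c i)) * h g ^ i) = 0"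
      by (simp only: hsum mult hpow to_fract_0)
    then show "(\<Sum>i\<le>n. to_fract (h (fps_of_poly (c i))) * to_fract (h g) ^ i) = 0" by simp
  qed (auto intro: hL c)
qed

text \<open>
  Differentiating \<open>\<Sum> c\<^sub>i g\<^sup>i = 0\<close> gives \<open>U + S g' = 0\<close>, where \<open>U\<close> and \<open>S\<close> are polynomials in \<open>g\<close>. In
  characteristic zero, \<open>S\<close> has smaller degree in \<open>g\<close> and is not the zero polynomial, so \<open>S\<close> does not vanish if the
  equation has minimal degree.
\<close>

lemma algebraic_over_fps_deriv:
  fixes g :: "'k::field_char_0 fps"
  assumes K: "subfield_set K" and g: "algebraic_over (ratfun_over K) (to_fract g)"
  shows "algebraic_over (ratfun_over K) (to_fract (fps_deriv g))"
proof -
  let ?A = "{x. algebraic_over (ratfun_over K) x}"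
  have A: "subfield_set ?A" by (intro subfield_set_algebraic subfield_set_ratfun_over)
  define P where "P n \<longleftrightarrow> (\<exists>c. (\<forall>i. c i \<in> polys_over K) \<and> c n \<noteq> 0 \<and>
    (\<Sum>i\<le>n. fps_of_poly (c i) * g ^ i) = 0)" for n
  define n where "n = (LEAST n. P n)"
  have "\<exists>n. P n" using ratfun_algebraicE[OF K g] unfolding P_def by metis
  then have "P n" unfolding n_def by (rule LeastI_ex)
  then obtain c where c: "\<And>i. c i \<in> polys_over K" "c n \<noteq> 0" "(\<Sum>i\<le>n. fps_of_poly (c i) * g ^ i) = 0"
    unfolding P_def by blast
  have "n \<noteq> 0"
    using c(2,3) fps_of_poly_eq_iff[of "c 0" 0] by (cases n) auto
  then obtain m where m: "n = Suc m" by (cases n) auto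
  define d where "d i = smult (of_nat (Suc i)) (c (Suc i))" for i
  define S where "S = (\<Sum>i\<le>m. fps_of_poly (d i) * g ^ i)"
  have d: "d i \<in> polys_over K" for i
    unfolding d_def using c(1) by (intro polys_over_closed(9)[OF K] subfield_set_of_nat[OF K])
  have "d m \<noteq> 0" using c(2) unfolding d_def m by (simp del: of_nat_Suc)
  have "\<not> P m" using not_less_Least[of m P] by (simp add: n_def[symmetric] m)
  then have "S \<noteq> 0" using d \<open>d m \<noteq> 0\<close> unfolding P_def S_def by blast
  define U where "U = (\<Sum>i\<le>n. fps_of_poly (pderiv (c i)) * g ^ i)"
  have "0 = fps_deriv (\<Sum>i\<le>n. fps_of_poly (c i) * g ^ i)" by (simp add: c(3))
  also have "\<dots> = U + (\<Sum>i\<le>n. fps_of_poly (c i) * fps_deriv (g ^ i))"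
    by (simp add: fps_deriv_sum sum.distrib fps_of_poly_pderiv U_def add.commute)
  also have "(\<Sum>i\<le>n. fps_of_poly (c i) * fps_deriv (g ^ i)) = S * fps_deriv g"
    unfolding m S_def sum.atMost_Suc_shift
    by (simp add: fps_deriv_power sum_distrib_left d_def fps_of_poly_smult algebra_simps
        del: power_Suc of_nat_Suc)
  finally have eq: "S * fps_deriv g = - U" by (simp add: eq_neg_iff_add_eq_0 add.commute)
  have mem: "to_fract (\<Sum>i\<le>k. fps_of_poly (c i) * g ^ i) \<in> ?A" if "\<And>i. c i \<in> polys_over K" for c k
    unfolding to_fract_sum to_fract_mult to_fract_power
  proof (intro subfield_set_sum[OF A] subfield_setD(4,9)[OF A])
    show "to_fract g \<in> ?A" using g by simp
    show "to_fract (fps_of_poly (c i)) \<in> ?A" for i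
      using algebraic_over_self[OF subfield_set_ratfun_over ratfun_over_poly[OF that]] by simp
  qed
  have "to_fract (fps_deriv g) = - to_fract U / to_fract S"
    using arg_cong[OF eq, of to_fract] \<open>S \<noteq> 0\<close> by (simp add: field_simps)
  moreover have "to_fract U \<in> ?A" unfolding U_def by (intro mem polys_over_closed(8)[OF K] c)
  moreover have "to_fract S \<in> ?A" unfolding S_def by (intro mem d)
  ultimately have "to_fract (fps_deriv g) \<in> ?A"
    using subfield_setD(5,8)[OF A] by presburger
  then show ?thesis by simp
qed

text \<open>
  Let \<open>P(x, \<phi>(x)) = 0\<close>. Substituting \<open>x = Y\<close> yields \<open>P(Y, x) = 0\<close>, a nontrivial equation for \<open>Y\<close> over the polynomials in
  \<open>x\<close>. In the proof, \<open>d\<close> collects the coefficients of \<open>P\<close> with respect to its first variable.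
\<close>

lemma algebraic_over_compositional_inverse:
  fixes \<phi> :: "'k::field fps"
  assumes K: "subfield_set K" and g: "algebraic_over (ratfun_over K) (to_fract \<phi>)"
    and Y: "Y $ 0 = 0" "\<phi> oo Y = fps_X"
  shows "algebraic_over (ratfun_over K) (to_fract Y)"
proof -
  obtain c n where c: "\<And>i. c i \<in> polys_over K" "c n \<noteq> 0" "(\<Sum>i\<le>n. fps_of_poly (c i) * \<phi> ^ i) = 0"
    using ratfun_algebraicE[OF K g] by metis
  define N where "N = (\<Sum>i\<le>n. degree (c i))"
  have N: "degree (c i) \<le> N" if "i \<le> n" for i
    unfolding N_def using that by (intro member_le_sum) auto
  define d where "d j = (\<Sum>i\<le>n. Polynomial.monom (coeff (c i) j) i)" for j
  have co: "coeff (d j) i = (if i \<le> n then coeff (c i) j else 0)" for i j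
    by (simp add: d_def coeff_sum)
  have d: "d j \<in> polys_over K" for j
    using c(1) subfield_setD(1)[OF K] by (auto simp: polys_over_def co)
  have "0 = (\<Sum>i\<le>n. fps_of_poly (c i) * \<phi> ^ i) oo Y" by (simp add: c(3))
  also have "\<dots> = (\<Sum>i\<le>n. (fps_of_poly (c i) oo Y) * fps_X ^ i)"
    by (simp add: fps_compose_sum_distrib fps_compose_mult_distrib[OF Y(1)] Y(2)
        flip: fps_compose_power[OF Y(1)])
  also have "\<dots> = (\<Sum>i\<le>n. (\<Sum>j\<le>N. fps_const (coeff (c i) j) * Y ^ j) * fps_X ^ i)"
  proof (intro sum.cong refl arg_cong2[where f = "(*)"])
    fix i assume "i \<in> {..n}"
    then have "fps_of_poly (c i) oo Y = (\<Sum>j\<le>N. fps_const (coeff (c i) j) * fps_X ^ j) oo Y"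
      using fps_of_poly_as_sum[OF N[of i]] by simp
    also have "\<dots> = (\<Sum>j\<le>N. fps_const (coeff (c i) j) * Y ^ j)"
      by (simp add: fps_compose_sum_distrib fps_compose_mult_distrib[OF Y(1)] Y
          flip: fps_compose_power[OF Y(1)])
    finally show "fps_of_poly (c i) oo Y = (\<Sum>j\<le>N. fps_const (coeff (c i) j) * Y ^ j)" .
  qed
  also have "\<dots> = (\<Sum>j\<le>N. fps_of_poly (d j) * Y ^ j)"
    unfolding d_def fps_of_poly_sum fps_of_poly_monom sum_distrib_right
    by (subst sum.swap) (simp add: algebra_simps)
  finally have "to_fract (\<Sum>j\<le>N. fps_of_poly (d j) * Y ^ j) = 0" by simp
  then have eq: "(\<Sum>j\<le>N. to_fract (fps_of_poly (d j)) * to_fract Y ^ j) = 0" by simp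
  have "coeff (d (degree (c n))) n \<noteq> 0" using c(2) by (simp add: co)
  then have "d (degree (c n)) \<noteq> 0" by force
  then show ?thesis
    using N[of n] fps_of_poly_eq_iff[of "d (degree (c n))" 0]
    by (intro algebraic_over_sumI[OF subfield_set_ratfun_over ratfun_over_poly[OF d] _ _ eq]) auto
qed

text \<open>
  Composition with \<open>Y\<close> turns an equation for \<open>g\<close> over \<open>K(x)\<close> into one for \<open>g \<circ> Y\<close> over \<open>K(Y)\<close>, which
  is contained in the algebraic elements over \<open>K(x)\<close>. The new equation is nontrivial because \<open>Y\<close> is not constant.
\<close>

lemma algebraic_over_compose:
  fixes g :: "'k::field fps"
  assumes K: "subfield_set K" and g: "algebraic_over (ratfun_over K) (to_fract g)"
    and "algebraic_over (ratfun_over K) (to_fract Y)" and Y: "Y $ 0 = 0" "Y \<noteq> 0"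
  shows "algebraic_over (ratfun_over K) (to_fract (g oo Y))"
proof (rule algebraic_over_trans[OF subfield_set_ratfun_over],
    rule algebraic_over_transfer[where h = "\<lambda>g. g oo Y", OF K g])
  show "to_fract (fps_const c oo Y) \<in> {x. algebraic_over (ratfun_over K) x}" if "c \<in> K" for c
    using that by (auto simp: ratfun_over_def intro!: algebraic_over_self subfield_set_generated
      intro: generated_subfield.incl)
qed (use assms in \<open>auto simp: fps_compose_add_distrib fps_compose_mult_distrib fps_compose_eq_0_iff
    intro!: subfield_set_algebraic subfield_set_ratfun_over\<close>)

section \<open>An equation with one catalytic variable\<close>

text \<open>
  The substitution \<open>y = Y(z)\<close> in \<open>P(z, y)\<close>. For \<open>Y(0) = 0\<close> only the terms up to \<open>y\<^sup>n\<close> contribute to the coefficient of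
  \<open>z\<^sup>n\<close>, so that the infinite sum may be truncated there.
\<close>

definition eval_series :: "'a::comm_ring_1 fps \<Rightarrow> 'a fps fps \<Rightarrow> 'a fps" where
  "eval_series Y P = Abs_fps (\<lambda>n. (\<Sum>l\<le>n. P $ l * Y ^ l) $ n)"

lemma eval_series_nth:
  assumes "Y $ 0 = 0" "n \<le> N"
  shows "eval_series Y P $ n = (\<Sum>l\<le>N. P $ l * Y ^ l) $ n"
proof -
  have "(P $ l * Y ^ l) $ n = 0" if "n < l" for l
    using that startsby_zero_power_prefix[OF assms(1)]
    by (auto simp: fps_mult_nth intro!: sum.neutral)
  then show ?thesis
    unfolding eval_series_def fps_nth_Abs_fps fps_sum_nth
    by (intro sum.mono_neutral_left) (use assms in auto)
qed

lemma eval_series_add: "eval_series Y (P + Q) = eval_series Y P + eval_series Y Q"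
  by (simp add: eval_series_def fps_eq_iff sum.distrib algebra_simps)

lemma eval_series_diff: "eval_series Y (P - Q) = eval_series Y P - eval_series Y Q"
  by (simp add: eval_series_def fps_eq_iff sum_subtractf algebra_simps)

lemma eval_series_mult:
  assumes "Y $ 0 = 0"
  shows "eval_series Y (P * Q) = eval_series Y P * eval_series Y Q"
proof (rule fps_ext)
  fix n
  let ?f = "\<lambda>i j. P $ i * Q $ j * Y ^ (i + j)"
  have "(eval_series Y P * eval_series Y Q) $ n = ((\<Sum>i\<le>n. P $ i * Y ^ i) * (\<Sum>j\<le>n. Q $ j * Y ^ j)) $ n"
    unfolding fps_mult_nth
    by (intro sum.cong refl arg_cong2[where f = "(*)"] eval_series_nth[OF assms]) auto
  also have "(\<Sum>i\<le>n. P $ i * Y ^ i) * (\<Sum>j\<le>n. Q $ j * Y ^ j) = (\<Sum>(i, j)\<in>{..n} \<times> {..n}. ?f i j)"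
    by (simp add: sum_product sum.cartesian_product power_add algebra_simps)
  \<comment> \<open>Multiples of \<open>Y\<^sup>k\<close> with \<open>k > n\<close> do not contribute to the coefficient of \<open>z\<^sup>n\<close>.\<close>
  also have "\<dots> $ n = (\<Sum>(i, j)\<in>{(i, j). i + j \<le> n}. ?f i j) $ n"
    unfolding fps_sum_nth
  proof (rule sum.mono_neutral_right)
    show "\<forall>p\<in>{..n} \<times> {..n} - {(i, j). i + j \<le> n}. (case p of (i, j) \<Rightarrow> ?f i j) $ n = 0"
      using startsby_zero_power_prefix[OF assms]
      by (auto simp: fps_mult_nth[of _ "Y ^ _"] intro!: sum.neutral)
  qed auto
  also have "(\<Sum>(i, j)\<in>{(i, j). i + j \<le> n}. ?f i j) = (\<Sum>l\<le>n. (P * Q) $ l * Y ^ l)"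
    unfolding sum.triangle_reindex_eq fps_mult_nth sum_distrib_right
    by (intro sum.cong) (auto simp: atMost_atLeast0)
  also have "\<dots> $ n = eval_series Y (P * Q) $ n" by (simp add: eval_series_def)
  finally show "eval_series Y (P * Q) $ n = (eval_series Y P * eval_series Y Q) $ n" ..
qed

lemma eval_series_const:
  assumes "Y $ 0 = 0"
  shows "eval_series Y (fps_const a) = a"
proof (rule fps_ext)
  fix n
  have "(\<Sum>l\<le>n. fps_const a $ l * Y ^ l) = (\<Sum>l\<le>n. if l = 0 then a else 0)"
    by (intro sum.cong) auto
  then show "eval_series Y (fps_const a) $ n = a $ n" by (simp add: eval_series_def)
qed

lemma eval_series_X:
  assumes "Y $ 0 = 0"
  shows "eval_series Y fps_X = Y"
proof (rule fps_ext)
  fix n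
  have "eval_series Y fps_X $ n = (\<Sum>l\<le>Suc n. fps_X $ l * Y ^ l) $ n"
    by (rule eval_series_nth[OF assms]) simp
  also have "(\<Sum>l\<le>Suc n. fps_X $ l * Y ^ l) = (\<Sum>l\<le>Suc n. if l = 1 then Y else 0)"
    by (intro sum.cong) (auto simp: fps_X_def)
  also have "\<dots> = Y" by (subst sum.delta) auto
  finally show "eval_series Y fps_X $ n = Y $ n" .
qed

lemma eval_series_const_coeffs: "eval_series Y (const_coeffs g) = g oo Y"
  by (simp add: eval_series_def const_coeffs_def fps_compose_def fps_eq_iff fps_sum_nth atMost_atLeast0)

lemma fps_deriv_const_coeffs: "fps_deriv (const_coeffs g) = const_coeffs (fps_deriv g)"
  for g :: "'a::comm_ring_1 fps"
  by (rule fps_ext) (simp add: const_coeffs_def flip: fps_of_nat)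

text \<open>
  The elimination in \<open>catalytic_parametrization\<close>. The first hypothesis amounts to \<open>(k - w)\<^sup>2 = u (1 + k)\<close>; adding a
  multiple of it to \<open>1 + k\<close> times the second one makes \<open>u\<close> disappear and leaves a multiple of \<open>k - w\<close>.
\<close>

lemma double_root_identity:
  fixes k w u t :: "'a::comm_ring_1"
  assumes "k * (1 + w) ^ 2 = (k + w ^ 2 - u) * (1 + k)"
    and "(k + t) * (1 + w) ^ 2 = (t + w) * (1 + k) + (k + w ^ 2 - u) * (k + t)"
  shows "(k - w) * ((1 + k) * (1 - k - 2 * t) + (k - w) * (t + k)) = 0"
proof -
  have 1: "(k - w) * (k - w) = u * (1 + k)"
    using assms(1) by (simp add: power2_eq_square algebra_simps)
  have 2: "(k - w) * (1 - k - 2 * t) + u * (t + k) = 0"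
    using assms(2) by (simp add: power2_eq_square algebra_simps)
  have "(k - w) * ((1 + k) * (1 - k - 2 * t) + (k - w) * (t + k)) =
      (1 + k) * ((k - w) * (1 - k - 2 * t)) + ((k - w) * (k - w)) * (t + k)"
    by (simp only: distrib_left ac_simps)
  also have "\<dots> = (1 + k) * ((k - w) * (1 - k - 2 * t) + u * (t + k))"
    unfolding 1 by (simp only: distrib_left ac_simps)
  finally show ?thesis by (simp add: 2)
qed

text \<open>
  The kernel method. Write \<open>j\<close> and \<open>j'\<close> for the values at \<open>y = Y(z)\<close> of \<open>J\<close> and of its derivative with respect to \<open>y\<close>. The
  equation at \<open>y = Y\<close> and its derivative at \<open>y = Y\<close> are two relations between \<open>j\<close>, \<open>j'\<close> and \<open>F\<close>. The unknown \<open>j'\<close> does not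
  have to be determined: up to a factor with constant term \<open>1\<close>, the relations say that \<open>Y j = w\<close>, and
  then the first one gives \<open>F\<close>.
\<close>

lemma catalytic_parametrization:
  fixes G F Y :: "'k::field_char_0 fps" and J :: "'k fps fps"
  defines "w \<equiv> Y ^ 2 * (fps_deriv G oo Y)"
  assumes eq: "fps_X * J = fps_const fps_X * (J + const_coeffs G - fps_const F) * (1 + fps_X * J)"
    and Y: "Y $ 0 = 0" "Y \<noteq> 0" "fps_X * (1 + w) ^ 2 = Y"
  shows "F = (G - fps_X ^ 3 * fps_deriv G ^ 2) oo Y"
proof -
  note ev = eval_series_add eval_series_diff eval_series_mult[OF Y(1)] eval_series_const[OF Y(1)]
    eval_series_X[OF Y(1)] eval_series_const_coeffs
  have ev1: "eval_series Y 1 = 1" using eval_series_const[OF Y(1), of 1] by simp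
  define j where "j = eval_series Y J"
  define j' where "j' = eval_series Y (fps_deriv J)"
  define g where "g = G oo Y"
  define g' where "g' = fps_deriv G oo Y"
  have e1: "Y * j = fps_X * (j + g - F) * (1 + Y * j)"
    using arg_cong[OF eq, of "eval_series Y"] by (simp add: ev ev1 j_def g_def)
  have "J + fps_X * fps_deriv J =
      fps_const fps_X * (fps_deriv J + const_coeffs (fps_deriv G)) * (1 + fps_X * J) +
      fps_const fps_X * (J + const_coeffs G - fps_const F) * (J + fps_X * fps_deriv J)"
    using arg_cong[OF eq, of fps_deriv] by (simp add: fps_deriv_const_coeffs algebra_simps)
  from arg_cong[OF this, of "eval_series Y"]
  have e2: "j + Y * j' = fps_X * (j' + g') * (1 + Y * j) + fps_X * (j + g - F) * (j + Y * j')"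
    by (simp add: ev ev1 j_def j'_def g_def g'_def)
  define k where "k = Y * j"
  define e where "e = F - g + Y ^ 3 * g' ^ 2"
  define \<delta> where "\<delta> = k - w"
  have w: "w = Y ^ 2 * g'" by (simp add: w_def g'_def)
  have F: "F = e + g - Y ^ 3 * g' ^ 2" by (simp add: e_def)
  \<comment> \<open>The error \<open>e\<close> of the claimed formula for \<open>F\<close> is kept as an unknown; \<open>u = Y e\<close> is its scaled version.\<close>
  define u where "u = Y * e"
  define t where "t = Y ^ 2 * j'"
  have h: "Y * (j + g - F) = k + w ^ 2 - u"
    by (simp add: F w k_def u_def algebra_simps power_numeral_reduce)
  have "Y * j * (1 + w) ^ 2 = (fps_X * (1 + w) ^ 2) * (j + g - F) * (1 + Y * j)"
    using arg_cong[OF e1, of "\<lambda>x. x * (1 + w) ^ 2"] by (simp only: ac_simps)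
  then have q1: "k * (1 + w) ^ 2 = (k + w ^ 2 - u) * (1 + k)"
    unfolding Y(3) h by (simp only: k_def)
  have "(j + Y * j') * (1 + w) ^ 2 = (fps_X * (1 + w) ^ 2) * (j' + g') * (1 + Y * j) +
      (fps_X * (1 + w) ^ 2) * (j + g - F) * (j + Y * j')"
    unfolding arg_cong[OF e2, of "\<lambda>x. x * (1 + w) ^ 2"]
    by (simp add: algebra_simps)
  then have "(j + Y * j') * (1 + w) ^ 2 = Y * (j' + g') * (1 + k) + (k + w ^ 2 - u) * (j + Y * j')"
    unfolding Y(3) h by (simp only: k_def)
  from arg_cong[OF this, of "\<lambda>x. Y * x"]
  have q2: "(k + t) * (1 + w) ^ 2 = (t + w) * (1 + k) + (k + w ^ 2 - u) * (k + t)"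
    by (simp add: k_def t_def w power2_eq_square algebra_simps)
  define B where "B = (1 + k) * (1 - k - 2 * t) + \<delta> * (t + k)"
  have "\<delta> * B = 0" unfolding B_def \<delta>_def by (rule double_root_identity[OF q1 q2])
  moreover have "B $ 0 = 1"
    using Y(1) by (simp add: B_def k_def \<delta>_def t_def w power2_eq_square)
  then have "B \<noteq> 0" by force
  ultimately have "\<delta> = 0" by simp
  moreover have "(1 + k) $ 0 = 1" using Y(1) by (simp add: k_def)
  then have "1 + k \<noteq> 0" by (metis fps_zero_nth zero_neq_one)
  moreover have "\<delta> ^ 2 = u * (1 + k)" using q1 by (simp add: \<delta>_def power2_eq_square algebra_simps)
  ultimately have "e = 0" using Y(2) by (simp add: u_def)
  then have "F = g - Y ^ 3 * g' ^ 2" by (simp add: F)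
  then show ?thesis
    by (simp add: g_def g'_def fps_compose_sub_distrib fps_compose_mult_distrib[OF Y(1)] Y(1)
        flip: fps_compose_power[OF Y(1)])
qed

lemma const_coeffs_mult: "const_coeffs (a * b) = const_coeffs a * const_coeffs b"
  for a :: "'a::comm_ring_1 fps"
proof (intro fps_ext)
  fix l n
  show "const_coeffs (a * b) $ l $ n = (const_coeffs a * const_coeffs b) $ l $ n"
    by (cases "n = 0") (simp_all add: const_coeffs_def fps_mult_nth fps_sum_nth)
qed

lemma const_coeffs_simps:
  fixes a b :: "'a::comm_ring_1 fps"
  shows "const_coeffs (a + b) = const_coeffs a + const_coeffs b"
    and "const_coeffs (fps_const c :: 'a fps) = fps_const (fps_const c)"
    and "const_coeffs (fps_X :: 'a fps) = fps_X"
    and "const_coeffs a = 0 \<Longrightarrow> a = 0"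
proof -
  show "a = 0" if "const_coeffs a = 0"
  proof (rule fps_ext)
    fix n
    have "const_coeffs a $ n $ 0 = 0" using that by simp
    then show "a $ n = 0 $ n" by (simp add: const_coeffs_def)
  qed
qed (auto simp: const_coeffs_def fps_eq_iff fps_X_def)

definition ratfun2_over :: "'k::field set \<Rightarrow> 'k fps fps fract set" where
  "ratfun2_over K = generated_subfield
    ((\<lambda>c. to_fract (fps_const (fps_const c))) ` K \<union> {to_fract (fps_const fps_X), to_fract fps_X})"

text \<open>
  The parametrization is applied to the compositional inverse \<open>Y\<close> of \<open>\<phi> = x / (1 + x\<^sup>2 G')\<^sup>2\<close>, which satisfies
  \<open>Y = z (1 + Y\<^sup>2 G'(Y))\<^sup>2\<close>.
\<close>

lemma catalytic_value_algebraic: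
  fixes G F :: "'k::field_char_0 fps" and J :: "'k fps fps"
  assumes K: "subfield_set K" and G: "algebraic_over (ratfun_over K) (to_fract G)"
    and eq: "fps_X * J = fps_const fps_X * (J + const_coeffs G - fps_const F) * (1 + fps_X * J)"
  shows "algebraic_over (ratfun_over K) (to_fract F)"
proof -
  let ?A = "{x. algebraic_over (ratfun_over K) x}"
  have A: "subfield_set ?A" by (intro subfield_set_algebraic subfield_set_ratfun_over)
  have X: "to_fract fps_X \<in> ?A"
    using algebraic_over_self[OF subfield_set_ratfun_over, of _ K]
    by (simp add: ratfun_over_def generated_subfield.incl)
  have G': "to_fract (fps_deriv G) \<in> ?A" using algebraic_over_fps_deriv[OF K G] by simp
  define D where "D = (1 + fps_X ^ 2 * fps_deriv G) ^ 2"
  define \<phi> where "\<phi> = fps_X * inverse D"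
  have D: "D $ 0 = 1" by (simp add: D_def power2_eq_square)
  then have "D \<noteq> 0" by force
  have \<phi>: "\<phi> * D = fps_X" using D by (simp add: \<phi>_def inverse_mult_eq_1 mult.assoc)
  have "to_fract D \<in> ?A"
    unfolding D_def to_fract_power to_fract_add to_fract_mult to_fract_1
    by (intro subfield_setD(2,3,4,9)[OF A] X G')
  then have "to_fract fps_X / to_fract D \<in> ?A" by (intro subfield_setD(8)[OF A] X)
  also have "to_fract fps_X / to_fract D = to_fract \<phi>"
    using \<open>D \<noteq> 0\<close> by (simp add: field_simps flip: \<phi>)
  finally have \<phi>_alg: "algebraic_over (ratfun_over K) (to_fract \<phi>)" by simp
  have \<phi>01: "\<phi> $ 0 = 0" "\<phi> $ 1 \<noteq> 0" using D by (simp_all add: \<phi>_def)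
  define Y where "Y = fps_inv \<phi>"
  have Y: "Y $ 0 = 0" "\<phi> oo Y = fps_X"
    using fps_inv_right[OF \<phi>01] by (simp_all add: Y_def fps_inv_def)
  have "Y \<noteq> 0"
  proof
    assume "Y = 0"
    then have "\<phi> oo Y = 0" using \<phi>01(1) by simp
    then show False using Y(2) by simp
  qed
  have "(\<phi> oo Y) * (D oo Y) = fps_X oo Y"
    by (simp add: \<phi> flip: fps_compose_mult_distrib[OF Y(1)])
  then have "fps_X * (1 + Y ^ 2 * (fps_deriv G oo Y)) ^ 2 = Y"
    by (simp add: Y D_def fps_compose_add_distrib fps_compose_mult_distrib[OF Y(1)]
        flip: fps_compose_power[OF Y(1)])
  then have F: "F = (G - fps_X ^ 3 * fps_deriv G ^ 2) oo Y"
    by (rule catalytic_parametrization[OF eq Y(1) \<open>Y \<noteq> 0\<close>])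
  have "to_fract (G - fps_X ^ 3 * fps_deriv G ^ 2) \<in> ?A"
    unfolding to_fract_power to_fract_diff to_fract_mult using G
    by (intro subfield_setD(4,7,9)[OF A] X G') simp
  then show ?thesis
    unfolding F using algebraic_over_compositional_inverse[OF K \<phi>_alg Y]
    by (intro algebraic_over_compose[OF K] Y(1) \<open>Y \<noteq> 0\<close>) auto
qed

text \<open>
  With \<open>F\<close> known to be algebraic, the functional equation is a quadratic equation for \<open>I\<close> over algebraic elements. Its leading
  coefficient is \<open>- z y\<close>, which is not zero.
\<close>

lemma catalytic_algebraic:
  fixes G :: "'k::field_char_0 fps" and I :: "'k fps fps"
  assumes K: "subfield_set K" and G: "algebraic_over (ratfun_over K) (to_fract G)"
    and eq: "fps_X * (I - const_coeffs G) =
      fps_const fps_X * (I - fps_const (I $ 0)) * (1 + fps_X * (I - const_coeffs G))"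
  shows "algebraic_over (ratfun2_over K) (to_fract I)"
    and "algebraic_over (ratfun_over K) (to_fract (I $ 0))"
proof -
  show F: "algebraic_over (ratfun_over K) (to_fract (I $ 0))"
    by (rule catalytic_value_algebraic[OF K G, where J = "I - const_coeffs G"]) (simp only: diff_add_cancel eq[symmetric])
  let ?L = "ratfun2_over K"
  let ?A = "{x. algebraic_over ?L x}"
  have L: "subfield_set ?L" unfolding ratfun2_over_def by (rule subfield_set_generated)
  have A: "subfield_set ?A" by (intro subfield_set_algebraic L)
  have c: "to_fract (fps_const (fps_const c)) \<in> ?L" if "c \<in> K" for c
    using that by (auto simp: ratfun2_over_def intro: generated_subfield.incl)
  have X: "to_fract fps_X \<in> ?L" and Z: "to_fract (fps_const fps_X) \<in> ?L"
    by (auto simp: ratfun2_over_def intro: generated_subfield.incl)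
  have "algebraic_over ?L (to_fract (fps_const (I $ 0)))"
    by (rule algebraic_over_transfer[OF K F]) (simp_all add: L c Z)
  then have F': "to_fract (fps_const (I $ 0)) \<in> ?A" by simp
  have "algebraic_over ?L (to_fract (const_coeffs G))"
  proof (rule algebraic_over_transfer[OF K G])
    show "const_coeffs (1 :: 'k fps) = 1" using const_coeffs_simps(2)[of 1] by simp
    show "a = 0" if "const_coeffs a = 0" for a :: "'k fps" using that by (rule const_coeffs_simps(4))
  qed (simp_all add: const_coeffs_mult const_coeffs_simps(1-3) L c X)
  then have G': "to_fract (const_coeffs G) \<in> ?A" by simp
  have X': "to_fract fps_X \<in> ?A" and Z': "to_fract (fps_const fps_X) \<in> ?A"
    using X Z by (auto intro: algebraic_over_self[OF L])
  define x z f g where "x = to_fract (fps_X :: 'k fps fps)" and "z = to_fract (fps_const (fps_X :: 'k fps))"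
    and "f = to_fract (fps_const (I $ 0))" and "g = to_fract (const_coeffs G)"
  have mem: "x \<in> ?A" "z \<in> ?A" "f \<in> ?A" "g \<in> ?A"
    using X' Z' F' G' by (simp_all add: x_def z_def f_def g_def)
  define c where "c = (\<lambda>n::nat. if n = 0 then z * f * (1 - x * g) - x * g else
    if n = 1 then x - z * (1 - x * g) + z * f * x else - (z * x))"
  have "x * (to_fract I - g) = z * (to_fract I - f) * (1 + x * (to_fract I - g))"
    using arg_cong[OF eq, of to_fract] by (simp add: x_def z_def f_def g_def)
  then have "(\<Sum>i\<le>2. c i * to_fract I ^ i) = 0"
    by (simp add: c_def numeral_2_eq_2 algebra_simps)
  moreover have "z * f * (1 - x * g) - x * g \<in> ?A" "x - z * (1 - x * g) + z * f * x \<in> ?A" "- (z * x) \<in> ?A"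
    by (intro subfield_setD(2,3,4,5,7)[OF A] mem)+
  then have "c i \<in> ?A" for i by (simp add: c_def)
  moreover have "c 2 \<noteq> 0" by (simp add: c_def x_def z_def)
  ultimately show "algebraic_over ?L (to_fract I)"
    by (intro algebraic_over_trans[OF L] algebraic_over_sumI[OF A, where c = c and n = 2 and j = 2]) auto
qed

theorem corollary9p2:
  fixes black white :: "'c::finite"
    and \<T> :: "'c tree set"
    and r :: nat
    and f :: "nat \<Rightarrow> 'c tree \<Rightarrow> complex"
  assumes "black \<noteq> white"
    and "troupe black \<T>"
    and "\<And>i. i < r \<Longrightarrow> insertion_additive black (f i)"
    and "algebraic_over (ratfun_field1 r) (to_fract (G_series \<T> r f))"
  shows "algebraic_over (ratfun_field2 r) (to_fract (I_series \<T> r f)) \<and>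
         algebraic_over (ratfun_field1 r) (to_fract (fps_nth (I_series \<T> r f) 0))"
proof -
  have K: "subfield_set (base_field r)"
    unfolding base_field_def by (rule subfield_set_generated)
  have fields: "ratfun_field1 r = ratfun_over (base_field r)" "ratfun_field2 r = ratfun2_over (base_field r)"
    by (simp_all only: ratfun_field1_def ratfun_over_def ratfun_field2_def ratfun2_over_def)
  note eq = I_series_functional_equation[OF assms(2,3)]
  show ?thesis
    using catalytic_algebraic[OF K assms(4)[unfolded fields] eq] unfolding fields by blast
qed

end
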